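(* Let $A$ be a centrosymmetric $\{0,1,-1\}$-matrix whose cell graph is a forest (has no cycles), and let $\mathcal{C}=\mathrm{Geom}(A)$. Then $$\liminf_{n\to\infty}\,|\mathcal{C}^{rc}_{2n}|^{1/n}\;\ge\;\lim_{n\to\infty}|\mathcal{C}_n|^{1/n}.$$
   Context: Permutations and classes: a permutation of size $n$ is a bijection of $[n]=\{1,\dots,n\}$. A permutation $\pi$ contains $\sigma$ if some subsequence of $\pi(1)\cdots\pi(n)$ has the same relative order as $\sigma$. A permutation class is a set of permutations closed downward under containment. $\mathcal{C}_n$ denotes the set of size-$n$ elements of $\mathcal{C}$. Reverse–complement: for $\pi$ of size $n$, $\mathrm{rc}(\pi)(i)=n+1-\pi(n+1-i)$, i.e. the diagram of $\pi$ rotated by a half turn. $\pi$ is centrosymmetric if $\mathrm{rc}(\pi)=\pi$. $\mathcal{C}^{rc}_n$ is the set of centrosymmetric elements of $\mathcal{C}_n$. A class is rc-invariant if $\mathrm{rc}(\mathcal{C})=\mathcal{C}$. Geometric grid classes: let $A$ be an $r\times c$ matrix with entries in $\{0,1,-1\}$ (row 1 at the top). Its standard figure is the subset of $[0,c]\times[0,r]$ obtained by placing in the unit square of cell $(i,j)$ (the square $[j-1,j]\times[r-i,r-i+1]$) the diagonal segment of slope $1$ if $A_{i,j}=1$, the diagonal segment of slope $-1$ if $A_{i,j}=-1$, and nothing if $A_{i,j}=0$. A set of $n$ points on the standard figure, no two sharing an $x$- or $y$-coordinate, determines the size-$n$ permutation whose diagram has the same relative order of points; $\mathrm{Geom}(A)$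 is the set of all permutations obtained this way (it is a permutation class, and $\lim_{n\to\infty}|\mathrm{Geom}(A)_n|^{1/n}$ is known to exist). $A$ is centrosymmetric if $A_{i,j}=A_{r+1-i,\,c+1-j}$ for all $i,j$. The cell graph of $A$ has the non-zero cells of $A$ as vertices, two cells being adjacent if they lie in the same row or same column and no non-zero cell lies between them in that row or column. *)

theory Defs
  imports
    "HOL-Analysis.Analysis"
    "HOL-Combinatorics.Permutations"
    "Jordan_Normal_Form.Matrix"
begin

text \<open>
  A permutation of size \<open>n\<close> is a function \<open>\<pi>\<close> with \<open>\<pi> permutes {1..n}\<close>. As such a function does not
  determine its size, a set of permutations is given by its size-\<open>n\<close> parts, as a family indexed by \<open>n\<close>.
\<close>

type_synonym perm_family = "nat \<Rightarrow> (nat \<Rightarrow> nat) set"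

definition rev_comp :: "nat \<Rightarrow> (nat \<Rightarrow> nat) \<Rightarrow> nat \<Rightarrow> nat" where
  "rev_comp n \<pi> = (\<lambda>i. if i \<in> {1..n} then n + 1 - \<pi> (n + 1 - i) else i)"

definition centrosymmetric_part :: "perm_family \<Rightarrow> perm_family" where
  "centrosymmetric_part C n = {\<pi> \<in> C n. rev_comp n \<pi> = \<pi>}"

text \<open>
  Matrix indices start at 0, with row 0 at the top, so the cell \<open>(i, j)\<close> of an \<open>r \<times> c\<close> matrix
  occupies the square \<open>[j, j + 1] \<times> [r - 1 - i, r - i]\<close>.
\<close>

definition cell_segment :: "int mat \<Rightarrow> nat \<Rightarrow> nat \<Rightarrow> (real \<times> real) set" where
  "cell_segment A i j =
    (let x = real j; y = real (dim_row A) - 1 - real i in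
     if A $$ (i, j) = 1 then closed_segment (x, y) (x + 1, y + 1)
     else if A $$ (i, j) = -1 then closed_segment (x, y + 1) (x + 1, y)
     else {})"

definition standard_figure :: "int mat \<Rightarrow> (real \<times> real) set" where
  "standard_figure A = (\<Union>i<dim_row A. \<Union>j<dim_col A. cell_segment A i j)"

definition same_relative_order :: "nat \<Rightarrow> (nat \<Rightarrow> nat) \<Rightarrow> (real \<times> real) set \<Rightarrow> bool" where
  "same_relative_order n \<pi> P \<longleftrightarrow>
    (\<exists>q. bij_betw q {1..n} P \<and>
      (\<forall>i\<in>{1..n}. \<forall>j\<in>{1..n}.
        (fst (q i) < fst (q j) \<longleftrightarrow> i < j) \<and> (snd (q i) < snd (q j) \<longleftrightarrow> \<pi> i < \<pi> j)))"

definition Geom :: "int mat \<Rightarrow> perm_family" where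
  "Geom A n = {\<pi>. \<pi> permutes {1..n} \<and>
    (\<exists>P \<subseteq> standard_figure A. finite P \<and> card P = n \<and> inj_on fst P \<and> inj_on snd P \<and>
      same_relative_order n \<pi> P)}"

definition centrosymmetric_mat :: "'a mat \<Rightarrow> bool" where
  "centrosymmetric_mat A \<longleftrightarrow>
    (\<forall>i<dim_row A. \<forall>j<dim_col A. A $$ (i, j) = A $$ (dim_row A - 1 - i, dim_col A - 1 - j))"

definition nonzero_cells :: "int mat \<Rightarrow> (nat \<times> nat) set" where
  "nonzero_cells A = {(i, j). i < dim_row A \<and> j < dim_col A \<and> A $$ (i, j) \<noteq> 0}"

definition cell_adj :: "int mat \<Rightarrow> nat \<times> nat \<Rightarrow> nat \<times> nat \<Rightarrow> bool" where
  "cell_adj A u v \<longleftrightarrow> u \<in> nonzero_cells A \<and> v \<in> nonzero_cells A \<and> u \<noteq> v \<and>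
    (fst u = fst v \<and>
       (\<nexists>k. min (snd u) (snd v) < k \<and> k < max (snd u) (snd v) \<and> (fst u, k) \<in> nonzero_cells A) \<or>
     snd u = snd v \<and>
       (\<nexists>k. min (fst u) (fst v) < k \<and> k < max (fst u) (fst v) \<and> (k, snd u) \<in> nonzero_cells A))"

text \<open>
  The graph is simple and undirected, so traversing one edge back and forth is not a cycle.
\<close>

definition graph_cycle :: "('v \<Rightarrow> 'v \<Rightarrow> bool) \<Rightarrow> 'v list \<Rightarrow> bool" where
  "graph_cycle E vs \<longleftrightarrow> 3 \<le> length vs \<and> distinct vs \<and>
    (\<forall>k<length vs. E (vs ! k) (vs ! (Suc k mod length vs)))"

definition cell_graph_forest :: "int mat \<Rightarrow> bool" where
  "cell_graph_forest A \<longleftrightarrow> (\<nexists>vs. graph_cycle (cell_adj A) vs)"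

end

theory Submission
  imports Defs
begin

text \<open>
  Since the cell graph is a centrosymmetric forest, the rows and columns can be oriented so that each
  non-zero cell is traversed consistently by its row and its column, and so that the half turn
  preserves the orientations. Each cell then has a base point, and a word over the non-zero cells
  draws a permutation by placing its letters farther and farther away from the base points;
  \<open>Geom A n\<close> consists of the patterns of the words of length \<open>n\<close>.

  Let \<open>D M\<close> be the set of patterns of the words with letter multiset \<open>M\<close>. If the multisets of \<open>u\<close>
  and \<open>v\<close> are known, the patterns of \<open>u\<close> and \<open>v\<close> can be recovered from the pattern of \<open>u @ v\<close>.
  Hence \<open>card (D M) * card (D N) \<le> card (D (M + N))\<close>, and \<open>y n = Max {card (D M) | size M = n}\<close> is
  supermultiplicative; by Fekete's lemma \<open>root n (y n)\<close> converges. There are only polynomially many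
  multisets of size \<open>n\<close>, so \<open>root n (card (Geom A n))\<close> has the same limit. Finally, the word \<open>w\<close>
  followed by the reversal of its half turn draws a centrosymmetric permutation of twice the size,
  from which the pattern of \<open>w\<close> can be recovered as before, so \<open>y n\<close> also bounds the number of
  centrosymmetric permutations of size \<open>2 * n\<close> from below.
\<close>

section \<open>Growth rates of supermultiplicative sequences\<close>

text \<open>Fekete's lemma: taking logarithms makes the sequence superadditive, and
  \<open>u n / n\<close> then converges to its supremum, which \<open>upper\<close> keeps
  finite.\<close>

lemma supermultiplicative_root_convergent:
  fixes y :: "nat \<Rightarrow> real"
  assumes super: "\<And>m n. y m * y n \<le> y (m + n)"
    and lower: "\<And>n. 1 \<le> y n"
    and upper: "\<And>n. y n \<le> B ^ n"
  shows "convergent (\<lambda>n. root n (y n))"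
proof -
  define u where "u n = ln (y n)" for n
  define L where "L = (SUP n\<in>{1..}. u n / real n)"
  have pos: "0 < y n" for n using lower[of n] by linarith
  have u_nonneg: "0 \<le> u n" for n using lower[of n] by (simp add: u_def)
  have u_add: "u m + u n \<le> u (m + n)" for m n
    using super[of m n] pos ln_mult[of "y m" "y n"] ln_mono[of "y m * y n" "y (m + n)"]
    by (simp add: u_def less_imp_neq[THEN not_sym])
  have u_mult: "real k * u m \<le> u (k * m)" for k m
  proof (induction k)
    case (Suc k)
    then show ?case using u_add[of m "k * m"] by (simp add: algebra_simps)
  qed (simp add: u_nonneg)
  have B: "1 \<le> B" using lower[of 1] upper[of 1] by simp
  have u_le: "u n / real n \<le> ln B" if "n \<ge> 1" for n
  proof -
    have "u n \<le> ln (B ^ n)" unfolding u_def using upper[of n] pos[of n] by simp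
    then show ?thesis using B that by (simp add: ln_realpow field_simps)
  qed
  then have bdd: "bdd_above ((\<lambda>n. u n / real n) ` {1..})" by (auto intro!: bdd_aboveI)
  have "(\<lambda>n. u n / real n) \<longlonglongrightarrow> L"
  proof (rule order_tendstoI)
    fix a assume "L < a"
    have "u n / real n < a" if "n \<ge> 1" for n
      using cSUP_upper[OF _ bdd, of n] that \<open>L < a\<close> unfolding L_def by fastforce
    then show "\<forall>\<^sub>F n in sequentially. u n / real n < a"
      by (auto simp: eventually_sequentially)
  next
    fix a assume "a < L"
    \<comment> \<open>Some quotient \<open>u m / m\<close> already exceeds \<open>a\<close>. Writing
      \<open>n\<close> as a multiple of \<open>m\<close> plus a remainder below \<open>m\<close>
      loses at most the factor \<open>1 - m / n\<close>, which tends to 1.\<close>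
    then obtain m where m: "m \<ge> 1" "a < u m / real m"
      using less_cSUP_iff[OF _ bdd, of a] unfolding L_def by auto
    have "(\<lambda>n. (1 - real m / real n) * (u m / real m)) \<longlonglongrightarrow> (1 - 0) * (u m / real m)"
      by (intro tendsto_intros lim_const_over_n)
    then have "\<forall>\<^sub>F n in sequentially. a < (1 - real m / real n) * (u m / real m)"
      using m by (auto dest: order_tendstoD)
    then show "\<forall>\<^sub>F n in sequentially. a < u n / real n"
      using eventually_gt_at_top[of 0]
    proof eventually_elim
      case (elim n)
      have "real n - real m \<le> real (n div m) * real m"
      proof -
        have "n = n div m * m + n mod m" by simp
        moreover have "n mod m < m" using m by simp
        ultimately have "n \<le> n div m * m + m" by linarith
        then show ?thesis by (simp flip: of_nat_mult of_nat_add)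
      qed
      then have "(real n - real m) * (u m / real m) \<le> real (n div m) * real m * (u m / real m)"
        using u_nonneg[of m] by (intro mult_right_mono) auto
      also have "\<dots> = real (n div m) * u m" using m by simp
      also have "\<dots> \<le> u (n div m * m)" by (rule u_mult)
      also have "\<dots> \<le> u n" using u_add[of "n div m * m" "n mod m"] u_nonneg[of "n mod m"] by simp
      finally have "(real n - real m) * (u m / real m) / real n \<le> u n / real n"
        by (rule divide_right_mono) simp
      moreover have "(1 - real m / real n) * (u m / real m) = (real n - real m) * (u m / real m) / real n"
        using elim by (simp add: diff_divide_distrib left_diff_distrib)
      ultimately show ?case using elim by linarith
    qed
  qed
  then have "(\<lambda>n. exp (u n / real n)) \<longlonglongrightarrow> exp L" by (rule tendsto_exp)
  moreover have "\<forall>\<^sub>F n in sequentially. exp (u n / real n) = root n (y n)"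
    using eventually_gt_at_top[of 0]
    by eventually_elim (use pos in \<open>simp add: u_def flip: ln_root\<close>)
  ultimately show ?thesis
    by (auto simp: convergent_def intro: Lim_transform_eventually)
qed

lemma root_polynomial_tendsto_1: "(\<lambda>n. root n (real (n + 1) ^ K)) \<longlonglongrightarrow> 1"
proof -
  have "(\<lambda>n. root n (real (n + 1))) \<longlonglongrightarrow> 1"
  proof (rule tendsto_sandwich)
    show "\<forall>\<^sub>F n in sequentially. 1 \<le> root n (real (n + 1))"
      using eventually_gt_at_top[of 0] by eventually_elim auto
    have "root n (real (n + 1)) \<le> root n 2 * root n (real n)" if "n > 0" for n
      using that by (simp flip: real_root_mult)
    then show "\<forall>\<^sub>F n in sequentially. root n (real (n + 1)) \<le> root n 2 * root n (real n)"
      by (auto intro: eventually_sequentiallyI[of 1])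
    show "(\<lambda>n. root n 2 * root n (real n)) \<longlonglongrightarrow> 1"
      using tendsto_mult[OF LIMSEQ_root_const[of 2] LIMSEQ_root] by simp
  qed simp
  then have "(\<lambda>n. root n (real (n + 1)) ^ K) \<longlonglongrightarrow> 1 ^ K" by (rule tendsto_power)
  moreover have "\<forall>\<^sub>F n in sequentially. root n (real (n + 1)) ^ K = root n (real (n + 1) ^ K)"
    using eventually_gt_at_top[of 0] by eventually_elim (simp add: real_root_power)
  ultimately show ?thesis by (auto intro: Lim_transform_eventually)
qed

text \<open>Here \<open>a\<close> will count the class, \<open>b\<close> its centrosymmetric members
  of size \<open>2 * n\<close>, and \<open>y\<close> the largest set of patterns with common letter
  counts. Polynomial factors vanish under the \<open>n\<close>-th root, so \<open>a\<close> inherits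
  the limit of \<open>y\<close>; \<open>b\<close> is only bounded below, hence the limes
  inferior.\<close>

lemma liminf_root_ge_lim_root:
  fixes a b y :: "nat \<Rightarrow> real"
  assumes "\<And>m n. y m * y n \<le> y (m + n)" "\<And>n. 1 \<le> y n" "\<And>n. y n \<le> B ^ n"
    and ya: "\<And>n. y n \<le> a n" and ay: "\<And>n. a n \<le> real (n + 1) ^ K * y n" and yb: "\<And>n. y n \<le> b n"
  shows "ereal (lim (\<lambda>n. root n (a n))) \<le> liminf (\<lambda>n. ereal (root n (b n)))"
proof -
  obtain L where L: "(\<lambda>n. root n (y n)) \<longlonglongrightarrow> L"
    using supermultiplicative_root_convergent assms(1-3) unfolding convergent_def by metis
  have "(\<lambda>n. root n (a n)) \<longlonglongrightarrow> L"
  proof (rule tendsto_sandwich[OF _ _ L])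
    show "\<forall>\<^sub>F n in sequentially. root n (y n) \<le> root n (a n)"
      using eventually_gt_at_top[of 0] by eventually_elim (use ya in simp)
    show "\<forall>\<^sub>F n in sequentially. root n (a n) \<le> root n (real (n + 1) ^ K) * root n (y n)"
      using eventually_gt_at_top[of 0] by eventually_elim (use ay in \<open>simp flip: real_root_mult\<close>)
    show "(\<lambda>n. root n (real (n + 1) ^ K) * root n (y n)) \<longlonglongrightarrow> L"
      using tendsto_mult[OF root_polynomial_tendsto_1 L] by simp
  qed
  then have "ereal (lim (\<lambda>n. root n (a n))) = ereal L" by (simp add: limI)
  also have "\<dots> = liminf (\<lambda>n. ereal (root n (y n)))"
    using L by (intro lim_imp_Liminf[symmetric]) auto
  also have "\<dots> \<le> liminf (\<lambda>n. ereal (root n (b n)))"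
    by (intro Liminf_mono) (use eventually_gt_at_top[of 0] in \<open>eventually_elim, use yb in simp\<close>)
  finally show ?thesis .
qed

section \<open>Symmetric orientations of forests\<close>

text \<open>Take a longest path inside \<open>W\<close>. All neighbours in \<open>W\<close> of its
  first vertex lie on it, since otherwise it could be prolonged. Of two distinct neighbours one has
  index at least 2 and closes a cycle.\<close>

lemma acyclic_graph_has_leaf:
  assumes "finite W" "W \<noteq> {}"
    and sym: "\<And>u v. E u v \<Longrightarrow> E v u"
    and irrefl: "\<And>u. \<not> E u u"
    and acyclic: "\<nexists>vs. graph_cycle E vs"
  shows "\<exists>u\<in>W. \<forall>x\<in>W. \<forall>y\<in>W. E u x \<longrightarrow> E u y \<longrightarrow> x = y"
proof (rule ccontr)
  assume no_leaf: "\<not> ?thesis"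
  define path where "path vs \<longleftrightarrow> vs \<noteq> [] \<and> distinct vs \<and> set vs \<subseteq> W \<and>
    (\<forall>k. Suc k < length vs \<longrightarrow> E (vs ! k) (vs ! Suc k))" for vs
  obtain w where "w \<in> W" using assms(2) by blast
  then have "path [w]" by (simp add: path_def)
  moreover have "length vs < Suc (card W)" if "path vs" for vs
    using that assms(1) by (metis card_mono distinct_card le_imp_less_Suc path_def)
  ultimately obtain vs where vs: "path vs" and max: "\<And>us. path us \<Longrightarrow> length us \<le> length vs"
    using ex_has_greatest_nat[of path "[w]" length "Suc (card W)"] by auto
  have hd_in: "vs ! 0 \<in> W" using vs by (auto simp: path_def)
  have idx: "\<exists>k. 0 < k \<and> k < length vs \<and> vs ! k = x" if x: "x \<in> W" "E (vs ! 0) x" for x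
  proof -
    have "x \<in> set vs"
    proof (rule ccontr)
      assume "x \<notin> set vs"
      then have "path (x # vs)"
        using vs x sym by (auto simp: path_def nth_Cons split: nat.split)
      then show False using max by fastforce
    qed
    then obtain k where "k < length vs" "vs ! k = x" by (auto simp: in_set_conv_nth)
    moreover have "k \<noteq> 0" using calculation x irrefl by metis
    ultimately show ?thesis by auto
  qed
  obtain x y where xy: "x \<in> W" "y \<in> W" "E (vs ! 0) x" "E (vs ! 0) y" "x \<noteq> y"
    using no_leaf hd_in by blast
  obtain k l where kl: "0 < k" "k < length vs" "vs ! k = x" "0 < l" "l < length vs" "vs ! l = y"
    using idx xy by metis
  then have "k \<noteq> l" using xy by auto
  then obtain m where m: "2 \<le> m" "m < length vs" "E (vs ! 0) (vs ! m)"
    using kl xy that[of k] that[of l] by fastforce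
  have "graph_cycle E (take (Suc m) vs)"
    unfolding graph_cycle_def
  proof (intro conjI allI impI)
    show "3 \<le> length (take (Suc m) vs)" using m by simp
    show "distinct (take (Suc m) vs)" using vs by (simp add: path_def)
    fix k assume "k < length (take (Suc m) vs)"
    then have k: "k < Suc m" by simp
    have len: "length (take (Suc m) vs) = Suc m" using m by simp
    show "E (take (Suc m) vs ! k) (take (Suc m) vs ! (Suc k mod length (take (Suc m) vs)))"
    proof (cases "k = m")
      case True
      then show ?thesis unfolding len using m sym by simp
    next
      case False
      then have "Suc k mod Suc m = Suc k" using k by simp
      then show ?thesis unfolding len using k False m vs by (simp add: path_def)
    qed
  qed
  then show False using acyclic by blast
qed

text \<open>
  An involutive automorphism of a forest may fix or swap the ends of an edge; that the weight of a
  swapped edge is 1 is what makes an invariant potential possible.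
\<close>

lemma forest_invariant_potential:
  fixes \<omega> :: "'v \<Rightarrow> 'v \<Rightarrow> int"
  assumes "finite W"
    and sym: "\<And>u v. E u v \<Longrightarrow> E v u"
    and irrefl: "\<And>u. \<not> E u u"
    and acyclic: "\<nexists>vs. graph_cycle E vs"
    and inv: "\<And>u. u \<in> W \<Longrightarrow> \<phi> u \<in> W \<and> \<phi> (\<phi> u) = u"
    and aut: "\<And>u v. u \<in> W \<Longrightarrow> v \<in> W \<Longrightarrow> E u v \<Longrightarrow> E (\<phi> u) (\<phi> v)"
    and \<omega>_sym: "\<And>u v. \<omega> u v = \<omega> v u"
    and \<omega>_sign: "\<And>u v. u \<in> W \<Longrightarrow> v \<in> W \<Longrightarrow> \<omega> u v \<in> {1, -1}"
    and \<omega>_aut: "\<And>u v. u \<in> W \<Longrightarrow> v \<in> W \<Longrightarrow> \<omega> (\<phi> u) (\<phi> v) = \<omega> u v"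
    and \<omega>_swap: "\<And>u. u \<in> W \<Longrightarrow> \<omega> u (\<phi> u) = 1"
  shows "\<exists>s. (\<forall>u\<in>W. s u \<in> {1, -1} \<and> s (\<phi> u) = s u) \<and>
    (\<forall>u\<in>W. \<forall>v\<in>W. E u v \<longrightarrow> s u = \<omega> u v * s v)"
  using assms(1) inv aut \<omega>_sign \<omega>_aut \<omega>_swap
proof (induction W rule: finite_psubset_induct)
  case (psubset W)
  note inv = psubset.prems(1) and aut = psubset.prems(2) and \<omega>_sign = psubset.prems(3)
    and \<omega>_aut = psubset.prems(4) and \<omega>_swap = psubset.prems(5)
  show ?case
  proof (cases "W = {}")
    case True
    then show ?thesis by simp
  next
    case False
    then obtain u where u: "u \<in> W" and leaf: "\<And>x y. x \<in> W \<Longrightarrow> y \<in> W \<Longrightarrow> E u x \<Longrightarrow> E u y \<Longrightarrow> x = y"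
      using acyclic_graph_has_leaf[OF psubset.hyps(1) False sym irrefl acyclic] by metis
    \<comment> \<open>The leaf is removed together with its image, so that \<open>\<phi>\<close>
      still acts on the rest; possibly \<open>\<phi> u = u\<close>.\<close>
    define W' where "W' = W - {u, \<phi> u}"
    have sub: "W' \<subset> W" using u by (auto simp: W'_def)
    have inv': "\<phi> x \<in> W' \<and> \<phi> (\<phi> x) = x" if "x \<in> W'" for x
      using that inv u unfolding W'_def by (metis Diff_iff insert_iff singletonD)
    have "\<exists>s. (\<forall>u\<in>W'. s u \<in> {1, -1} \<and> s (\<phi> u) = s u) \<and>
        (\<forall>u\<in>W'. \<forall>v\<in>W'. E u v \<longrightarrow> s u = \<omega> u v * s v)"
    proof (rule psubset.IH[OF sub])
      show "\<phi> x \<in> W' \<and> \<phi> (\<phi> x) = x" if "x \<in> W'" for x using inv' that .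
      show "E (\<phi> x) (\<phi> y)" if "x \<in> W'" "y \<in> W'" "E x y" for x y
        using aut that sub by blast
      show "\<omega> x y \<in> {1, -1}" "\<omega> (\<phi> x) (\<phi> y) = \<omega> x y" if "x \<in> W'" "y \<in> W'" for x y
        using \<omega>_sign[of x y] \<omega>_aut[of x y] that sub by auto
      show "\<omega> x (\<phi> x) = 1" if "x \<in> W'" for x
        using \<omega>_swap[of x] that sub by auto
    qed
    then obtain s where s: "\<And>x. x \<in> W' \<Longrightarrow> s x \<in> {1, -1} \<and> s (\<phi> x) = s x"
        "\<And>x y. x \<in> W' \<Longrightarrow> y \<in> W' \<Longrightarrow> E x y \<Longrightarrow> s x = \<omega> x y * s y"
      by blast
    \<comment> \<open>A leaf has at most one neighbour in \<open>W'\<close>, and that neighbour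
      forces the value at \<open>u\<close>. Without one the value is free, and 1 is chosen.\<close>
    define a where "a = (if \<exists>v\<in>W'. E u v then \<omega> u (SOME v. v \<in> W' \<and> E u v) * s (SOME v. v \<in> W' \<and> E u v) else 1)"
    have a: "a = \<omega> u v * s v" if v: "v \<in> W'" "E u v" for v
    proof -
      have "(SOME v. v \<in> W' \<and> E u v) = v"
        by (rule some_equality) (use v leaf in \<open>auto simp: W'_def\<close>)
      then show ?thesis using v by (auto simp: a_def)
    qed
    have a_sign: "a \<in> {1, -1}"
    proof (cases "\<exists>v\<in>W'. E u v")
      case True
      then obtain v where v: "v \<in> W'" "E u v" by blast
      then have "\<omega> u v \<in> {1, -1}" "s v \<in> {1, -1}" using \<omega>_sign u s by (auto simp: W'_def)
      then show ?thesis using a[OF v] by auto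
    qed (simp add: a_def)
    define s' where "s' = s(u := a, \<phi> u := a)"
    have s'_W': "s' x = s x" if "x \<in> W'" for x using that by (auto simp: s'_def W'_def)
    have s'_u: "s' u = a" "s' (\<phi> u) = a" by (auto simp: s'_def)
    have W: "x \<in> W' \<or> x = u \<or> x = \<phi> u" if "x \<in> W" for x using that by (auto simp: W'_def)
    have W'_W: "x \<in> W" if "x \<in> W'" for x using that by (auto simp: W'_def)
    have flip: "s' y = \<omega> y x * s' x" if "s' x = \<omega> x y * s' y" "x \<in> W" "y \<in> W" for x y
    proof -
      have "\<omega> x y \<in> {1, -1}" using \<omega>_sign that by blast
      then show ?thesis using that(1) \<omega>_sym[of x y] by auto
    qed
    \<comment> \<open>Edges leaving \<open>\<phi> u\<close> are images of edges leaving
      \<open>u\<close>, so invariance of \<open>s\<close> and of the weights carries the relation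
      over.\<close>
    have out: "s' x = \<omega> x y * s' y" if x: "x = u \<or> x = \<phi> u" and y: "y \<in> W'" and "E x y" for x y
      using x
    proof
      assume "x = u"
      then show ?thesis using a y \<open>E x y\<close> s'_u s'_W' by simp
    next
      assume x: "x = \<phi> u"
      have "E u (\<phi> y)" using aut[of x y] inv[OF u] W'_W[OF y] \<open>E x y\<close> x by auto
      then have "a = \<omega> u (\<phi> y) * s (\<phi> y)" using a inv' y by blast
      also have "\<omega> u (\<phi> y) = \<omega> x y" using \<omega>_aut[of u "\<phi> y"] inv' y W'_W u x by auto
      finally show ?thesis using s y s'_W' s'_u x by simp
    qed
    have "s' x = \<omega> x y * s' y" if xy: "x \<in> W" "y \<in> W" "E x y" for x y
    proof -
      consider "x \<in> W'" "y \<in> W'" | "x = u \<or> x = \<phi> u" "y \<in> W'" | "x \<in> W'" "y = u \<or> y = \<phi> u"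
        | "x = u \<or> x = \<phi> u" "y = u \<or> y = \<phi> u" using W[OF xy(1)] W[OF xy(2)] by blast
      then show ?thesis
      proof cases
        case 1
        then show ?thesis using s that s'_W' by simp
      next
        case 2
        then show ?thesis using out that by blast
      next
        case 3
        then show ?thesis using out[of y x] flip[of y x] that sym by blast
      next
        \<comment> \<open>Only an edge between \<open>u\<close> and \<open>\<phi> u\<close> is left.
          Both ends carry the value \<open>a\<close>, which is consistent because a swapped edge has
          weight 1.\<close>
        case 4
        then show ?thesis using irrefl that \<omega>_swap[OF u] \<omega>_sym[of "\<phi> u" u] s'_u by auto
      qed
    qed
    moreover have "s' x \<in> {1, -1} \<and> s' (\<phi> x) = s' x" if "x \<in> W" for x
      using W[OF that]
    proof (elim disjE)
      assume "x \<in> W'"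
      then show ?thesis using s(1)[of x] s'_W'[of x] s'_W'[of "\<phi> x"] inv'[of x] by simp
    qed (use s'_u a_sign inv[OF u] in simp_all)
    ultimately show ?thesis by blast
  qed
qed

section \<open>The half turn on the cell graph\<close>

definition cell_flip :: "'a mat \<Rightarrow> nat \<times> nat \<Rightarrow> nat \<times> nat" where
  "cell_flip A c = (dim_row A - 1 - fst c, dim_col A - 1 - snd c)"

lemma cell_flip_nonzero:
  assumes "centrosymmetric_mat A" "c \<in> nonzero_cells A"
  shows "cell_flip A c \<in> nonzero_cells A" "cell_flip A (cell_flip A c) = c"
    "A $$ cell_flip A c = A $$ c"
proof -
  obtain i j where c: "c = (i, j)" "i < dim_row A" "j < dim_col A" "A $$ (i, j) \<noteq> 0"
    using assms(2) by (auto simp: nonzero_cells_def)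
  then have "A $$ (dim_row A - Suc i, dim_col A - Suc j) = A $$ (i, j)"
    using assms(1)[unfolded centrosymmetric_mat_def, rule_format, of i j] by simp
  then show "cell_flip A c \<in> nonzero_cells A" "cell_flip A (cell_flip A c) = c"
    "A $$ cell_flip A c = A $$ c"
    using c by (auto simp: nonzero_cells_def cell_flip_def)
qed

lemma finite_nonzero_cells: "finite (nonzero_cells A)"
  by (rule finite_subset[of _ "{..<dim_row A} \<times> {..<dim_col A}"]) (auto simp: nonzero_cells_def)

lemma cell_adj_sym: "cell_adj A u v \<Longrightarrow> cell_adj A v u"
  by (auto simp: cell_adj_def max.commute min.commute)

text \<open>The half turn reverses every row and column, so a cell separating the images would come
  from a cell separating \<open>u\<close> and \<open>v\<close>.\<close>

lemma cell_adj_flip: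
  assumes "centrosymmetric_mat A" "cell_adj A u v"
  shows "cell_adj A (cell_flip A u) (cell_flip A v)"
proof -
  obtain i j k l where uv: "u = (i, j)" "v = (k, l)" by (metis surj_pair)
  have nz: "(i, j) \<in> nonzero_cells A" "(k, l) \<in> nonzero_cells A" "(i, j) \<noteq> (k, l)"
    using assms(2) uv by (auto simp: cell_adj_def)
  then have lt: "i < dim_row A" "j < dim_col A" "k < dim_row A" "l < dim_col A"
    by (auto simp: nonzero_cells_def)
  have flipZ: "cell_flip A c \<in> nonzero_cells A" if "c \<in> nonzero_cells A" for c
    using cell_flip_nonzero assms(1) that by blast
  note flipped = flipZ[OF nz(1)] flipZ[OF nz(2)]
  have ne: "cell_flip A u \<noteq> cell_flip A v"
    using nz lt uv by (auto simp: cell_flip_def)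
  consider "i = k" "\<nexists>m. min j l < m \<and> m < max j l \<and> (i, m) \<in> nonzero_cells A"
    | "j = l" "\<nexists>m. min i k < m \<and> m < max i k \<and> (m, j) \<in> nonzero_cells A"
    using assms(2) uv by (auto simp: cell_adj_def)
  then show ?thesis
  proof cases
    case 1
    have "\<not> (min (dim_col A - 1 - j) (dim_col A - 1 - l) < m \<and>
      m < max (dim_col A - 1 - j) (dim_col A - 1 - l) \<and> (dim_row A - 1 - i, m) \<in> nonzero_cells A)" for m
    proof
      assume m: "min (dim_col A - 1 - j) (dim_col A - 1 - l) < m \<and>
        m < max (dim_col A - 1 - j) (dim_col A - 1 - l) \<and> (dim_row A - 1 - i, m) \<in> nonzero_cells A"
      then have "(i, dim_col A - 1 - m) \<in> nonzero_cells A"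
        using flipZ[of "(dim_row A - 1 - i, m)"] lt by (auto simp: cell_flip_def)
      moreover have "min j l < dim_col A - 1 - m" "dim_col A - 1 - m < max j l"
        using m lt by (auto simp: min_def max_def split: if_splits)
      ultimately show False using 1 by blast
    qed
    then show ?thesis
      using flipped ne 1 uv by (simp add: cell_adj_def cell_flip_def)
  next
    case 2
    have "\<not> (min (dim_row A - 1 - i) (dim_row A - 1 - k) < m \<and>
      m < max (dim_row A - 1 - i) (dim_row A - 1 - k) \<and> (m, dim_col A - 1 - j) \<in> nonzero_cells A)" for m
    proof
      assume m: "min (dim_row A - 1 - i) (dim_row A - 1 - k) < m \<and>
        m < max (dim_row A - 1 - i) (dim_row A - 1 - k) \<and> (m, dim_col A - 1 - j) \<in> nonzero_cells A"
      then have "(dim_row A - 1 - m, j) \<in> nonzero_cells A"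
        using flipZ[of "(m, dim_col A - 1 - j)"] lt by (auto simp: cell_flip_def)
      moreover have "min i k < dim_row A - 1 - m" "dim_row A - 1 - m < max i k"
        using m lt by (auto simp: min_def max_def split: if_splits)
      ultimately show False using 2 by blast
    qed
    then show ?thesis
      using flipped ne 2 uv by (simp add: cell_adj_def cell_flip_def)
  qed
qed

text \<open>\<open>cell_adj\<close> relates only consecutive non-zero cells of a line; this extends
  an equality between neighbours to all cells of the line.\<close>

lemma constant_if_consecutive:
  fixes S :: "nat set"
  assumes "\<And>i j. i \<in> S \<Longrightarrow> j \<in> S \<Longrightarrow> i < j \<Longrightarrow> \<nexists>k. i < k \<and> k < j \<and> k \<in> S \<Longrightarrow> f i = f j"
    and "i \<in> S" "j \<in> S"
  shows "f i = f j"
proof -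
  have less: "f i = f j" if "i \<in> S" "j \<in> S" "i < j" for i j
    using that
  proof (induction "j - i" arbitrary: i j rule: less_induct)
    case less
    show ?case
    proof (cases "\<exists>k. i < k \<and> k < j \<and> k \<in> S")
      case True
      then obtain k where k: "i < k" "k < j" "k \<in> S" by blast
      then show ?thesis using less.hyps[of k i] less.hyps[of j k] less.prems by auto
    next
      case False
      then show ?thesis using assms(1) less.prems by blast
    qed
  qed
  show ?thesis using less assms(2,3) by (metis linorder_neqE_nat)
qed

text \<open>Directions of the lines amount to a potential on the cell graph. A cell and its image
  under the half turn have equal entries, so swapped edges have weight 1 and the potential can be
  chosen invariant.\<close>

lemma centrosymmetric_forest_orientation:
  assumes entries: "elements_mat A \<subseteq> {0, 1, -1}"
    and centro: "centrosymmetric_mat A"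
    and forest: "cell_graph_forest A"
  obtains colup rowup :: "nat \<Rightarrow> bool"
  where "\<And>i j. (i, j) \<in> nonzero_cells A \<Longrightarrow> A $$ (i, j) = (if colup j = rowup i then 1 else -1)"
    and "\<And>j. j < dim_col A \<Longrightarrow> colup (dim_col A - 1 - j) = colup j"
    and "\<And>i. i < dim_row A \<Longrightarrow> rowup (dim_row A - 1 - i) = rowup i"
proof -
  let ?Z = "nonzero_cells A"
  \<comment> \<open>The value \<open>s u\<close> is meant as the direction of the column of
    \<open>u\<close>, and \<open>s u * A $$ u\<close> as that of its row. Adjacent cells must agree
    on the first within a column and on the second within a row; as entries are signs, the latter
    reads \<open>s u = A $$ u * A $$ v * s v\<close>.\<close>
  define \<omega> where "\<omega> u v = (if snd u = snd v then 1 else A $$ u * A $$ v)" for u v :: "nat \<times> nat"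
  note flip = cell_flip_nonzero[OF centro]
  have sign: "A $$ u \<in> {1, -1}" if "u \<in> ?Z" for u
  proof -
    have "A $$ u \<in> elements_mat A" using that by (force simp: nonzero_cells_def elements_mat_def)
    then show ?thesis using entries that by (auto simp: nonzero_cells_def)
  qed
  have "\<exists>s. (\<forall>u\<in>?Z. s u \<in> {1, -1} \<and> s (cell_flip A u) = s u) \<and>
    (\<forall>u\<in>?Z. \<forall>v\<in>?Z. cell_adj A u v \<longrightarrow> s u = \<omega> u v * s v)"
  proof (rule forest_invariant_potential)
    show "finite ?Z" by (rule finite_nonzero_cells)
    show "cell_adj A v u" if "cell_adj A u v" for u v using that by (rule cell_adj_sym)
    show "\<not> cell_adj A u u" for u by (simp add: cell_adj_def)
    show "\<nexists>vs. graph_cycle (cell_adj A) vs" using forest by (simp add: cell_graph_forest_def)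
    show "cell_flip A u \<in> ?Z \<and> cell_flip A (cell_flip A u) = u" if "u \<in> ?Z" for u
      using flip that by blast
    show "cell_adj A (cell_flip A u) (cell_flip A v)" if "cell_adj A u v" for u v
      using cell_adj_flip[OF centro that] .
    show "\<omega> u v = \<omega> v u" for u v by (simp add: \<omega>_def)
    show "\<omega> u v \<in> {1, -1}" if "u \<in> ?Z" "v \<in> ?Z" for u v
      using sign[OF that(1)] sign[OF that(2)] by (auto simp: \<omega>_def)
    show "\<omega> (cell_flip A u) (cell_flip A v) = \<omega> u v" if "u \<in> ?Z" "v \<in> ?Z" for u v
    proof -
      have "snd (cell_flip A u) = snd (cell_flip A v) \<longleftrightarrow> snd u = snd v"
        using that by (auto simp: cell_flip_def nonzero_cells_def)
      then show ?thesis using flip(3) that by (simp add: \<omega>_def)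
    qed
    show "\<omega> u (cell_flip A u) = 1" if "u \<in> ?Z" for u
      using sign[OF that] flip(3)[OF that] by (auto simp: \<omega>_def)
  qed
  then obtain s where s_sign: "\<And>u. u \<in> ?Z \<Longrightarrow> s u \<in> {1, -1}"
    and s_flip: "\<And>u. u \<in> ?Z \<Longrightarrow> s (cell_flip A u) = s u"
    and s_adj: "\<And>u v. u \<in> ?Z \<Longrightarrow> v \<in> ?Z \<Longrightarrow> cell_adj A u v \<Longrightarrow> s u = \<omega> u v * s v"
    by blast
  have col_const: "s (i, j) = s (k, j)" if "(i, j) \<in> ?Z" "(k, j) \<in> ?Z" for i j k
  proof (rule constant_if_consecutive[where S = "{i. (i, j) \<in> ?Z}" and f = "\<lambda>i. s (i, j)"])
    fix i k assume i: "i \<in> {i. (i, j) \<in> ?Z}" and k: "k \<in> {i. (i, j) \<in> ?Z}" and "i < k"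
      "\<nexists>l. i < l \<and> l < k \<and> l \<in> {i. (i, j) \<in> ?Z}"
    then have "cell_adj A (i, j) (k, j)" by (auto simp: cell_adj_def)
    then show "s (i, j) = s (k, j)"
      using s_adj[of "(i, j)" "(k, j)"] i k by (simp add: \<omega>_def)
  qed (use that in auto)
  have row_const: "s (i, j) * A $$ (i, j) = s (i, l) * A $$ (i, l)"
    if "(i, j) \<in> ?Z" "(i, l) \<in> ?Z" for i j l
  proof (rule constant_if_consecutive[where S = "{j. (i, j) \<in> ?Z}" and f = "\<lambda>j. s (i, j) * A $$ (i, j)"])
    fix j l assume jl: "j \<in> {j. (i, j) \<in> ?Z}" "l \<in> {j. (i, j) \<in> ?Z}" "j < l"
      "\<nexists>m. j < m \<and> m < l \<and> m \<in> {j. (i, j) \<in> ?Z}"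
    then have "cell_adj A (i, j) (i, l)" by (auto simp: cell_adj_def)
    then have "s (i, j) = A $$ (i, j) * A $$ (i, l) * s (i, l)"
      using s_adj[of "(i, j)" "(i, l)"] jl by (simp add: \<omega>_def)
    then show "s (i, j) * A $$ (i, j) = s (i, l) * A $$ (i, l)"
      using sign[of "(i, j)"] jl by auto
  qed (use that in auto)
  \<comment> \<open>The universal quantifier makes lines without non-zero cells count as upward.
    Their images are empty as well, so symmetry persists.\<close>
  define colup where "colup j \<longleftrightarrow> (\<forall>i. (i, j) \<in> ?Z \<longrightarrow> s (i, j) = 1)" for j
  define rowup where "rowup i \<longleftrightarrow> (\<forall>j. (i, j) \<in> ?Z \<longrightarrow> s (i, j) * A $$ (i, j) = 1)" for i
  have colup: "colup j \<longleftrightarrow> s (i, j) = 1" if "(i, j) \<in> ?Z" for i j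
    using col_const that unfolding colup_def by metis
  have rowup: "rowup i \<longleftrightarrow> s (i, j) * A $$ (i, j) = 1" if "(i, j) \<in> ?Z" for i j
    using row_const that unfolding rowup_def by metis
  have colup_flip: "colup (dim_col A - 1 - j)" if "j < dim_col A" "colup j" for j
    unfolding colup_def
  proof (intro allI impI)
    fix i assume i: "(i, dim_col A - 1 - j) \<in> ?Z"
    then have "(dim_row A - 1 - i, j) \<in> ?Z" using flip(1)[OF i] that by (simp add: cell_flip_def)
    then show "s (i, dim_col A - 1 - j) = 1"
      using s_flip[OF i] that by (simp add: cell_flip_def colup_def)
  qed
  have rowup_flip: "rowup (dim_row A - 1 - i)" if "i < dim_row A" "rowup i" for i
    unfolding rowup_def
  proof (intro allI impI)
    fix j assume j: "(dim_row A - 1 - i, j) \<in> ?Z"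
    then have "(i, dim_col A - 1 - j) \<in> ?Z" using flip(1)[OF j] that by (simp add: cell_flip_def)
    then show "s (dim_row A - 1 - i, j) * A $$ (dim_row A - 1 - i, j) = 1"
      using s_flip[OF j, symmetric] flip(3)[OF j, symmetric] that by (simp add: cell_flip_def rowup_def)
  qed
  show ?thesis
  proof (rule that[of colup rowup])
    show "A $$ (i, j) = (if colup j = rowup i then 1 else -1)" if "(i, j) \<in> ?Z" for i j
      using colup[OF that] rowup[OF that] s_sign[OF that] sign[OF that] by auto
    show "colup (dim_col A - 1 - j) = colup j" if "j < dim_col A" for j
      using colup_flip[of j] colup_flip[of "dim_col A - 1 - j"] that by auto
    show "rowup (dim_row A - 1 - i) = rowup i" if "i < dim_row A" for i
      using rowup_flip[of i] rowup_flip[of "dim_row A - 1 - i"] that by auto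
  qed
qed

section \<open>Patterns drawn by words\<close>

text \<open>Initial segments of a total relation are nested, so an initial segment is determined by
  its cardinality, and an isomorphism carries it to the one of equal size.\<close>

lemma bij_betw_image_initial_segment:
  assumes bij: "bij_betw f U U'" and fin: "finite U'"
    and pres: "\<And>s t. s \<in> U \<Longrightarrow> t \<in> U \<Longrightarrow> R s t \<longleftrightarrow> R' (f s) (f t)"
    and total: "\<And>s t. s \<in> U' \<Longrightarrow> t \<in> U' \<Longrightarrow> s \<noteq> t \<Longrightarrow> R' s t \<or> R' t s"
    and S: "S \<subseteq> U" "\<And>s t. s \<in> U \<Longrightarrow> t \<in> S \<Longrightarrow> R s t \<Longrightarrow> s \<in> S"
    and S': "S' \<subseteq> U'" "\<And>s t. s \<in> U' \<Longrightarrow> t \<in> S' \<Longrightarrow> R' s t \<Longrightarrow> s \<in> S'"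
    and card: "card S = card S'"
  shows "f ` S = S'"
proof -
  have fS: "f ` S \<subseteq> U'" using bij S(1) by (auto simp: bij_betw_def)
  have down: "s \<in> f ` S" if st: "s \<in> U'" "t \<in> f ` S" "R' s t" for s t
  proof -
    obtain a where "a \<in> U" "s = f a" using st(1) bij bij_betw_imp_surj_on by blast
    moreover obtain b where "b \<in> S" "t = f b" using st(2) by blast
    ultimately show ?thesis using pres S st(3) by blast
  qed
  have card': "card (f ` S) = card S'"
    using bij S(1) card by (metis bij_betw_def card_image inj_on_subset)
  have "f ` S \<subseteq> S' \<or> S' \<subseteq> f ` S"
  proof (rule ccontr)
    assume "\<not> ?thesis"
    then obtain a b where "a \<in> f ` S" "a \<notin> S'" "b \<in> S'" "b \<notin> f ` S" by blast
    moreover have "a \<in> U'" "b \<in> U'" "a \<noteq> b" using calculation fS S'(1) by auto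
    ultimately show False using total[of a b] down S'(2) by blast
  qed
  then show ?thesis
    using card' fS S'(1) fin by (metis card_subset_eq finite_subset)
qed

lemma rank_bij:
  assumes irrefl: "\<And>s. s < n \<Longrightarrow> \<not> R s s"
    and trans: "\<And>s t u. s < n \<Longrightarrow> t < n \<Longrightarrow> u < n \<Longrightarrow> R s t \<Longrightarrow> R t u \<Longrightarrow> R s u"
    and total: "\<And>s t. s < n \<Longrightarrow> t < n \<Longrightarrow> s \<noteq> t \<Longrightarrow> R s t \<or> R t s"
  defines "e \<equiv> \<lambda>t. Suc (card {s. s < n \<and> R s t})"
  shows "bij_betw e {..<n} {1..n}"
    and "\<And>s t. s < n \<Longrightarrow> t < n \<Longrightarrow> R s t \<longleftrightarrow> e s < e t"
proof -
  have mono: "e s < e t" if "s < n" "t < n" "R s t" for s t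
  proof -
    have "{x. x < n \<and> R x s} \<subset> {x. x < n \<and> R x t}"
      using that trans irrefl by blast
    then show ?thesis unfolding e_def by (simp add: psubset_card_mono)
  qed
  then show iff: "R s t \<longleftrightarrow> e s < e t" if "s < n" "t < n" for s t
    using that total[of s t] by (metis less_asym less_irrefl)
  have inj: "inj_on e {..<n}"
    using mono total by (metis inj_onI lessThan_iff less_irrefl)
  have "e t \<in> {1..n}" if "t < n" for t
  proof -
    have "{s. s < n \<and> R s t} \<subset> {..<n}" using that irrefl by blast
    then have "card {s. s < n \<and> R s t} < n"
      using psubset_card_mono[of "{..<n}"] by simp
    then show ?thesis by (simp add: e_def)
  qed
  then have "e ` {..<n} \<subseteq> {1..n}" by auto
  then have "e ` {..<n} = {1..n}"
    using inj by (intro card_subset_eq) (simp_all add: card_image)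
  then show "bij_betw e {..<n} {1..n}" using inj by (simp add: bij_betw_def)
qed

text \<open>Allows a bijection onto \<open>{1..n}\<close> to be recovered from the order that it
  induces; the successor is due to ranks starting at 1.\<close>

lemma bij_betw_eq_rank:
  fixes e :: "nat \<Rightarrow> nat"
  assumes "bij_betw e {..<n} {1..n}" "t < n"
  shows "e t = Suc (card {s. s < n \<and> e s < e t})"
proof -
  have range: "e s \<in> {1..n}" if "s < n" for s
    using bij_betwE[OF assms(1)] that by blast
  note et = range[OF assms(2)]
  have "e ` {s. s < n \<and> e s < e t} = {1..<e t}"
  proof
    show "e ` {s. s < n \<and> e s < e t} \<subseteq> {1..<e t}" using range by auto
    show "{1..<e t} \<subseteq> e ` {s. s < n \<and> e s < e t}"
    proof
      fix i assume i: "i \<in> {1..<e t}"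
      then have "i \<in> e ` {..<n}" using bij_betw_imp_surj_on[OF assms(1)] et by simp
      then show "i \<in> e ` {s. s < n \<and> e s < e t}" using i by auto
    qed
  qed
  moreover have "inj_on e {s. s < n \<and> e s < e t}"
    using assms by (auto simp: bij_betw_def intro: inj_on_subset)
  ultimately have "card {s. s < n \<and> e s < e t} = e t - 1" by (metis card_image card_atLeastLessThan)
  then show ?thesis using et by simp
qed

text \<open>A multiset over \<open>Z\<close> is determined by its multiplicities, each at most
  \<open>n\<close>. The exponent does not depend on \<open>n\<close>, so the bound is
  polynomial.\<close>

lemma card_multisets_le:
  assumes "finite Z"
  shows "finite {M. set_mset M \<subseteq> Z \<and> size M = n}"
    and "card {M. set_mset M \<subseteq> Z \<and> size M = n} \<le> (n + 1) ^ card Z"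
proof -
  let ?V = "{M. set_mset M \<subseteq> Z \<and> size M = n}"
  let ?F = "Z \<rightarrow>\<^sub>E {..n}"
  have inj: "inj_on (\<lambda>M. restrict (count M) Z) ?V"
  proof (rule inj_onI)
    fix M N assume M: "M \<in> ?V" and N: "N \<in> ?V" and eq: "restrict (count M) Z = restrict (count N) Z"
    show "M = N"
    proof (rule multiset_eqI)
      fix x
      show "count M x = count N x"
      proof (cases "x \<in> Z")
        case True
        then show ?thesis using fun_cong[OF eq, of x] by simp
      next
        case False
        then have "x \<notin># M" "x \<notin># N" using M N by auto
        then show ?thesis by (simp add: not_in_iff)
      qed
    qed
  qed
  have sub: "(\<lambda>M. restrict (count M) Z) ` ?V \<subseteq> ?F"
    by (auto simp: count_le_size)
  have fin: "finite ?F" using assms by (intro finite_PiE) auto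
  show "finite ?V" using inj sub fin by (rule inj_on_finite)
  show "card ?V \<le> (n + 1) ^ card Z"
    using card_inj_on_le[OF inj sub fin] assms by (simp add: card_PiE)
qed

text \<open>
  A word places its letters one after the other, moving away from the base points of the cells. The
  letter at position \<open>s\<close> lies in the line (column or row) \<open>k (w ! s)\<close>, which is traversed upwards if
  \<open>up (w ! s)\<close> and downwards otherwise.
\<close>

definition word_less :: "('c \<Rightarrow> int) \<Rightarrow> ('c \<Rightarrow> bool) \<Rightarrow> 'c list \<Rightarrow> nat \<Rightarrow> nat \<Rightarrow> bool" where
  "word_less k up w s t \<longleftrightarrow> k (w ! s) < k (w ! t) \<or>
    k (w ! s) = k (w ! t) \<and> (if up (w ! s) then s < t else t < s)"

lemma word_less_total:
  assumes "\<And>c d. k c = k d \<Longrightarrow> up c = up d" "s \<noteq> t"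
  shows "word_less k up w s t \<or> word_less k up w t s"
  using assms(2) assms(1)[of "w ! s" "w ! t"] by (auto simp: word_less_def)

lemma word_less_append_left:
  "s < length u \<Longrightarrow> t < length u \<Longrightarrow> word_less k up (u @ v) s t \<longleftrightarrow> word_less k up u s t"
  by (simp add: word_less_def nth_append)

lemma word_less_append_right:
  "word_less k up (u @ v) (s + length u) (t + length u) \<longleftrightarrow> word_less k up v s t"
  by (simp add: word_less_def nth_append)

text \<open>For each threshold \<open>b\<close> the positions whose line number is below
  \<open>b\<close> form an initial segment, whose size is dictated by the letter counts. Hence
  \<open>f\<close> preserves being below every \<open>b\<close>, and so the line number
  itself.\<close>

lemma word_less_bij_key:
  assumes bij: "bij_betw f {..<length w} {..<length w'}"
    and pres: "\<And>s t. s < length w \<Longrightarrow> t < length w \<Longrightarrow>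
      word_less k up w s t \<longleftrightarrow> word_less k up w' (f s) (f t)"
    and up: "\<And>c d. k c = k d \<Longrightarrow> up c = up d"
    and mset: "mset w = mset w'"
    and t: "t < length w"
  shows "k (w' ! f t) = k (w ! t)"
proof -
  have below: "k (w ! t) < b \<longleftrightarrow> k (w' ! f t) < b" for b
  proof -
    let ?S = "{t. t < length w \<and> k (w ! t) < b}" and ?S' = "{t. t < length w' \<and> k (w' ! t) < b}"
    have "card ?S = size (filter_mset (\<lambda>c. k c < b) (mset w))"
      using length_filter_conv_card[of "\<lambda>c. k c < b" w] by (simp flip: size_mset mset_filter)
    moreover have "card ?S' = size (filter_mset (\<lambda>c. k c < b) (mset w'))"
      using length_filter_conv_card[of "\<lambda>c. k c < b" w'] by (simp flip: size_mset mset_filter)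
    ultimately have card: "card ?S = card ?S'" using mset by simp
    have "f ` ?S = ?S'"
    proof (rule bij_betw_image_initial_segment[OF bij, where R = "word_less k up w" and R' = "word_less k up w'"])
      show "word_less k up w' s t \<or> word_less k up w' t s" if "s \<noteq> t" for s t
        using word_less_total[of k up s t, OF up that] .
      show "card ?S = card ?S'" by (rule card)
      show "word_less k up w s t \<longleftrightarrow> word_less k up w' (f s) (f t)"
        if "s \<in> {..<length w}" "t \<in> {..<length w}" for s t
        using pres that by simp
    qed (auto simp: word_less_def)
    moreover have "f t \<in> f ` ?S \<longleftrightarrow> t \<in> ?S"
      using bij t by (intro inj_on_image_mem_iff[of f "{..<length w}"]) (auto simp: bij_betw_def)
    moreover have "f t < length w'" using bij t by (auto simp: bij_betw_def)
    ultimately show ?thesis using t by auto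
  qed
  show ?thesis using below[of "k (w ! t)"] below[of "k (w' ! f t)"] by linarith
qed

section \<open>The pattern of a word and its recovery from a concatenation\<close>

locale word_diagram =
  fixes kx ky :: "'c \<Rightarrow> int" and upx upy :: "'c \<Rightarrow> bool"
  assumes upx: "kx c = kx d \<Longrightarrow> upx c = upx d"
    and upy: "ky c = ky d \<Longrightarrow> upy c = upy d"
    and cell_eqI: "kx c = kx d \<Longrightarrow> ky c = ky d \<Longrightarrow> c = d"
begin

abbreviation "xless \<equiv> word_less kx upx"
abbreviation "yless \<equiv> word_less ky upy"

text \<open>\<open>e t\<close> is the horizontal rank of the point placed by position
  \<open>t\<close>, and \<open>\<pi> (e t)\<close> its vertical rank.\<close>

definition draws :: "'c list \<Rightarrow> (nat \<Rightarrow> nat) \<Rightarrow> bool" where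
  "draws w \<pi> \<longleftrightarrow> \<pi> permutes {1..length w} \<and>
    (\<exists>e. bij_betw e {..<length w} {1..length w} \<and>
      (\<forall>s<length w. \<forall>t<length w.
        (xless w s t \<longleftrightarrow> e s < e t) \<and> (yless w s t \<longleftrightarrow> \<pi> (e s) < \<pi> (e t))))"

definition word_iso :: "'c list \<Rightarrow> 'c list \<Rightarrow> (nat \<Rightarrow> nat) \<Rightarrow> bool" where
  "word_iso w w' f \<longleftrightarrow> bij_betw f {..<length w} {..<length w'} \<and>
    (\<forall>s<length w. \<forall>t<length w.
      (xless w s t \<longleftrightarrow> xless w' (f s) (f t)) \<and> (yless w s t \<longleftrightarrow> yless w' (f s) (f t)))"

lemma word_rank_bij:
  assumes "\<And>c d. k c = k d \<Longrightarrow> up c = up d"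
  defines "e \<equiv> \<lambda>w t. Suc (card {s. s < length w \<and> word_less k up w s t})"
  shows "bij_betw (e w) {..<length w} {1..length w}"
    and "s < length w \<Longrightarrow> t < length w \<Longrightarrow> word_less k up w s t \<longleftrightarrow> e w s < e w t"
proof -
  have irrefl: "\<not> word_less k up w s s" for s by (simp add: word_less_def)
  have trans: "word_less k up w s u" if "word_less k up w s t" "word_less k up w t u" for s t u
    using that assms(1)[of "w ! s" "w ! t"] by (auto simp: word_less_def split: if_splits)
  note total = word_less_total[of k up _ _ w, OF assms(1)]
  show "bij_betw (e w) {..<length w} {1..length w}"
    unfolding e_def by (rule rank_bij) (use irrefl trans total in blast)+
  show "s < length w \<Longrightarrow> t < length w \<Longrightarrow> word_less k up w s t \<longleftrightarrow> e w s < e w t"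
    unfolding e_def by (rule rank_bij) (use irrefl trans total in blast)+
qed

lemma draws_exists: "\<exists>\<pi>. draws w \<pi>"
proof -
  define n where "n = length w"
  define e where "e = (\<lambda>t. Suc (card {s. s < length w \<and> xless w s t}))"
  define h where "h = (\<lambda>t. Suc (card {s. s < length w \<and> yless w s t}))"
  have e: "bij_betw e {..<n} {1..n}" "\<And>s t. s < n \<Longrightarrow> t < n \<Longrightarrow> xless w s t \<longleftrightarrow> e s < e t"
    using word_rank_bij[of kx upx, OF upx, where w = w] by (auto simp: e_def n_def)
  have h: "bij_betw h {..<n} {1..n}" "\<And>s t. s < n \<Longrightarrow> t < n \<Longrightarrow> yless w s t \<longleftrightarrow> h s < h t"
    using word_rank_bij[of ky upy, OF upy, where w = w] by (auto simp: h_def n_def)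
  define \<pi> where "\<pi> i = (if i \<in> {1..n} then h (inv_into {..<n} e i) else i)" for i
  have \<pi>_e: "\<pi> (e t) = h t" if "t < n" for t
    using that e(1) by (auto simp: \<pi>_def bij_betw_def)
  have "bij_betw (h \<circ> inv_into {..<n} e) {1..n} {1..n}"
    using e(1) h(1) bij_betw_inv_into bij_betw_trans by blast
  then have "bij_betw \<pi> {1..n} {1..n}"
    by (rule bij_betw_cong[THEN iffD1, rotated]) (simp add: \<pi>_def)
  then have "\<pi> permutes {1..n}" by (rule bij_imp_permutes) (auto simp: \<pi>_def)
  then show ?thesis
    unfolding draws_def using e h \<pi>_e by (intro exI[of _ \<pi>] conjI exI[of _ e]) (auto simp: n_def)
qed

text \<open>The two orders of the word force \<open>e\<close> and \<open>\<pi> \<circ> e\<close> to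
  be their rank functions, and together these determine \<open>\<pi>\<close> on
  \<open>{1..n}\<close>.\<close>

lemma draws_unique:
  assumes "draws w \<pi>" "draws w \<rho>"
  shows "\<pi> = \<rho>"
proof -
  define n where "n = length w"
  have rank: "\<exists>e. bij_betw e {..<n} {1..n} \<and> (\<forall>t<n. e t = Suc (card {s. s < n \<and> xless w s t}) \<and>
      \<sigma> (e t) = Suc (card {s. s < n \<and> yless w s t}))" if drw: "draws w \<sigma>" for \<sigma>
  proof -
    have \<sigma>: "\<sigma> permutes {1..n}" using drw by (simp add: draws_def n_def)
    obtain e where e: "bij_betw e {..<n} {1..n}"
        "\<And>s t. s < n \<Longrightarrow> t < n \<Longrightarrow> (xless w s t \<longleftrightarrow> e s < e t) \<and> (yless w s t \<longleftrightarrow> \<sigma> (e s) < \<sigma> (e t))"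
      using drw unfolding draws_def n_def by blast
    have "bij_betw (\<sigma> \<circ> e) {..<n} {1..n}"
      using e(1) permutes_imp_bij[OF \<sigma>] bij_betw_trans by blast
    note rank\<sigma> = bij_betw_eq_rank[OF this]
    have "e t = Suc (card {s. s < n \<and> xless w s t}) \<and> \<sigma> (e t) = Suc (card {s. s < n \<and> yless w s t})"
      if t: "t < n" for t
    proof -
      have "{s. s < n \<and> xless w s t} = {s. s < n \<and> e s < e t}"
        "{s. s < n \<and> yless w s t} = {s. s < n \<and> \<sigma> (e s) < \<sigma> (e t)}"
        using e(2) t by auto
      then show ?thesis using bij_betw_eq_rank[OF e(1) t] rank\<sigma>[OF t] by simp
    qed
    then show ?thesis using e(1) by blast
  qed
  obtain e where e: "bij_betw e {..<n} {1..n}"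
      "\<And>t. t < n \<Longrightarrow> e t = Suc (card {s. s < n \<and> xless w s t}) \<and> \<pi> (e t) = Suc (card {s. s < n \<and> yless w s t})"
    using rank[OF assms(1)] by blast
  obtain e' where e': "bij_betw e' {..<n} {1..n}"
      "\<And>t. t < n \<Longrightarrow> e' t = Suc (card {s. s < n \<and> xless w s t}) \<and> \<rho> (e' t) = Suc (card {s. s < n \<and> yless w s t})"
    using rank[OF assms(2)] by blast
  have perm: "\<pi> permutes {1..n}" "\<rho> permutes {1..n}" using assms by (auto simp: draws_def n_def)
  show ?thesis
  proof
    fix i
    show "\<pi> i = \<rho> i"
    proof (cases "i \<in> {1..n}")
      case True
      then have "i \<in> e ` {..<n}" using bij_betw_imp_surj_on[OF e(1)] by simp
      then obtain t where "t < n" "i = e t" by auto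
      then show ?thesis using e(2)[of t] e'(2)[of t] by metis
    next
      case False
      then show ?thesis using perm by (metis permutes_not_in)
    qed
  qed
qed

definition pattern :: "'c list \<Rightarrow> nat \<Rightarrow> nat" where
  "pattern w = (THE \<pi>. draws w \<pi>)"

lemma draws_iff_pattern: "draws w \<pi> \<longleftrightarrow> \<pi> = pattern w"
proof -
  have "\<exists>!\<pi>. draws w \<pi>" using draws_exists draws_unique by blast
  then show ?thesis unfolding pattern_def by (metis theI')
qed

lemma pattern_permutes: "pattern w permutes {1..length w}"
  using draws_iff_pattern draws_def by blast

lemma pattern_eq_imp_iso:
  assumes "pattern w = pattern w'" "length w = length w'"
  shows "\<exists>f. word_iso w w' f"
proof -
  define n where "n = length w"
  obtain e where e: "bij_betw e {..<n} {1..n}" "\<And>s t. s < n \<Longrightarrow> t < n \<Longrightarrow>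
      (xless w s t \<longleftrightarrow> e s < e t) \<and> (yless w s t \<longleftrightarrow> pattern w (e s) < pattern w (e t))"
    using draws_iff_pattern[of w "pattern w"] unfolding draws_def n_def by blast
  obtain e' where e': "bij_betw e' {..<n} {1..n}" "\<And>s t. s < n \<Longrightarrow> t < n \<Longrightarrow>
      (xless w' s t \<longleftrightarrow> e' s < e' t) \<and> (yless w' s t \<longleftrightarrow> pattern w (e' s) < pattern w (e' t))"
    using draws_iff_pattern[of w' "pattern w"] assms unfolding draws_def n_def by auto
  define f where "f = inv_into {..<n} e' \<circ> e"
  have bij: "bij_betw f {..<n} {..<n}"
    unfolding f_def using e(1) e'(1) bij_betw_inv_into bij_betw_trans by blast
  have "e' (f t) = e t" if "t < n" for t
    using that e(1) e'(1) unfolding f_def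
    by (metis bij_betwE bij_betw_inv_into_right comp_apply lessThan_iff)
  moreover have "f t < n" if "t < n" for t using bij that by (auto simp: bij_betw_def)
  ultimately have "word_iso w w' f"
    unfolding word_iso_def using bij e(2) e'(2) assms(2) by (simp add: n_def)
  then show ?thesis by blast
qed

lemma iso_imp_pattern_eq:
  assumes "word_iso w w' f" "length w = length w'"
  shows "pattern w = pattern w'"
proof -
  define n where "n = length w"
  obtain e where e: "bij_betw e {..<n} {1..n}" "\<And>s t. s < n \<Longrightarrow> t < n \<Longrightarrow>
      (xless w' s t \<longleftrightarrow> e s < e t) \<and> (yless w' s t \<longleftrightarrow> pattern w' (e s) < pattern w' (e t))"
    using draws_iff_pattern[of w' "pattern w'"] assms unfolding draws_def n_def by auto
  have bij: "bij_betw f {..<n} {..<n}" using assms by (simp add: word_iso_def n_def)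
  then have lt: "f t < n" if "t < n" for t using that by (auto simp: bij_betw_def)
  have "draws w (pattern w')"
    unfolding draws_def
  proof (intro conjI exI[of _ "e \<circ> f"])
    show "pattern w' permutes {1..length w}" using pattern_permutes assms(2) by metis
    show "bij_betw (e \<circ> f) {..<length w} {1..length w}"
      using bij e(1) bij_betw_trans unfolding n_def by blast
  qed (use assms e(2) lt in \<open>auto simp: word_iso_def n_def\<close>)
  then show ?thesis using draws_iff_pattern by metis
qed

text \<open>
  With the letter counts of both halves fixed, the lines and hence the cells of all points can be
  read off the pattern of a concatenation; within a cell, the points of the first half come first.
\<close>

lemma pattern_append_cancel:
  assumes "pattern (u @ v) = pattern (u' @ v')" and u: "mset u = mset u'" and v: "mset v = mset v'"
  shows "pattern u = pattern u'" "pattern v = pattern v'"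
proof -
  let ?w = "u @ v" and ?w' = "u' @ v'"
  have len: "length u = length u'" "length v = length v'" using u v by (metis size_mset)+
  have mset: "mset ?w = mset ?w'" using u v by simp
  obtain f where iso: "word_iso ?w ?w' f"
    using pattern_eq_imp_iso assms(1) len by fastforce
  define n where "n = length ?w"
  have n': "length ?w' = n" using len by (simp add: n_def)
  have bij: "bij_betw f {..<n} {..<n}" using iso n' by (simp add: word_iso_def n_def)
  have x: "xless ?w s t \<longleftrightarrow> xless ?w' (f s) (f t)" and y: "yless ?w s t \<longleftrightarrow> yless ?w' (f s) (f t)"
    if "s < n" "t < n" for s t
    using iso that unfolding word_iso_def n_def by blast+
  have lt: "f t < n" if "t < n" for t using bij that by (auto simp: bij_betw_def)
  have bij': "bij_betw f {..<length ?w} {..<length ?w'}" using bij n' by (simp add: n_def)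
  have cell: "?w' ! f t = ?w ! t" if "t < n" for t
  proof (rule cell_eqI)
    show "kx (?w' ! f t) = kx (?w ! t)"
      by (rule word_less_bij_key[where k = kx and up = upx, OF bij' _ upx mset]) (use x that in \<open>auto simp: n_def\<close>)
    show "ky (?w' ! f t) = ky (?w ! t)"
      by (rule word_less_bij_key[where k = ky and up = upy, OF bij' _ upy mset]) (use y that in \<open>auto simp: n_def\<close>)
  qed
  \<comment> \<open>On the positions carrying a fixed letter \<open>c\<close>, \<open>f\<close> is
    increasing, whichever direction the column has. The occurrences within the first half form an
    initial segment, and \<open>u\<close> and \<open>u'\<close> contain equally many of
    them.\<close>
  have first: "t < length u \<longleftrightarrow> f t < length u" if t: "t < n" for t
  proof -
    define c where "c = ?w ! t"
    let ?U = "{t. t < n \<and> ?w ! t = c}" and ?U' = "{t. t < n \<and> ?w' ! t = c}"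
    let ?S = "{t. t < length u \<and> ?w ! t = c}" and ?S' = "{t. t < length u \<and> ?w' ! t = c}"
    have lu: "length u \<le> n" by (simp add: n_def)
    have "f ` ?U = ?U'"
    proof
      show "f ` ?U \<subseteq> ?U'" using lt cell by auto
      show "?U' \<subseteq> f ` ?U"
      proof
        fix z assume z: "z \<in> ?U'"
        then have "z \<in> f ` {..<n}" using bij_betw_imp_surj_on[OF bij] by simp
        then obtain t where "t < n" "z = f t" by auto
        then show "z \<in> f ` ?U" using z cell by auto
      qed
    qed
    then have bijU: "bij_betw f ?U ?U'"
      using bij by (auto simp: bij_betw_def intro: inj_on_subset)
    have ord: "s < t \<longleftrightarrow> f s < f t" if st: "s \<in> ?U" "t \<in> ?U" for s t
    proof -
      have "xless ?w s t \<longleftrightarrow> (if upx c then s < t else t < s)" using st by (simp add: word_less_def)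
      moreover have "xless ?w t s \<longleftrightarrow> (if upx c then t < s else s < t)" using st by (simp add: word_less_def)
      moreover have "xless ?w' (f s) (f t) \<longleftrightarrow> (if upx c then f s < f t else f t < f s)"
        using st cell by (simp add: word_less_def)
      moreover have "xless ?w' (f t) (f s) \<longleftrightarrow> (if upx c then f t < f s else f s < f t)"
        using st cell by (simp add: word_less_def)
      ultimately show ?thesis using x[of s t] x[of t s] st by (auto split: if_splits)
    qed
    have cS: "card ?S = count (mset u) c"
    proof -
      have "?S = {i. i < length u \<and> c = u ! i}" by (auto simp: nth_append)
      then show ?thesis using length_filter_conv_card[of "(=) c" u]
        by (simp add: count_mset count_list_eq_length_filter)
    qed
    have cS': "card ?S' = count (mset u') c"
    proof -
      have "?S' = {i. i < length u' \<and> c = u' ! i}" using len by (auto simp: nth_append)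
      then show ?thesis using length_filter_conv_card[of "(=) c" u']
        by (simp add: count_mset count_list_eq_length_filter)
    qed
    have "f ` ?S = ?S'"
    proof (rule bij_betw_image_initial_segment[OF bijU, where R = "(<)" and R' = "(<)"])
      show "card ?S = card ?S'" using cS cS' u by simp
      show "s < t \<longleftrightarrow> f s < f t" if "s \<in> ?U" "t \<in> ?U" for s t using ord that by blast
    qed (use lu in auto)
    moreover have "f t \<in> f ` ?S \<longleftrightarrow> t \<in> ?S"
      using bij t lu by (intro inj_on_image_mem_iff[of f "{..<n}"]) (auto simp: bij_betw_def)
    ultimately show ?thesis using cell[OF t] c_def by auto
  qed
  have inj_u: "inj_on f {..<length u}"
    by (rule inj_on_subset[OF bij_betw_imp_inj_on[OF bij]]) (auto simp: n_def)
  have fu: "f ` {..<length u} = {..<length u}"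
  proof (rule card_subset_eq)
    show "f ` {..<length u} \<subseteq> {..<length u}"
    proof (rule image_subsetI)
      fix t assume "t \<in> {..<length u}"
      then show "f t \<in> {..<length u}" using first[of t] by (simp add: n_def)
    qed
    show "card (f ` {..<length u}) = card {..<length u}" using inj_u by (rule card_image)
  qed simp
  have isou: "word_iso u u' f"
    unfolding word_iso_def
  proof (intro conjI allI impI)
    show "bij_betw f {..<length u} {..<length u'}"
      using inj_u fu len by (simp add: bij_betw_def)
    fix s t assume st: "s < length u" "t < length u"
    then have "f s < length u'" "f t < length u'" using fu len by auto
    then show "xless u s t \<longleftrightarrow> xless u' (f s) (f t)" "yless u s t \<longleftrightarrow> yless u' (f s) (f t)"
      using x[of s t] y[of s t] st by (simp_all add: word_less_append_left n_def)
  qed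
  then show "pattern u = pattern u'" using iso_imp_pattern_eq len by blast
  \<comment> \<open>\<open>f\<close> restricted to the second half, renumbered from 0. By
    \<open>first\<close> it stays in the second half, so the subtraction does not truncate.\<close>
  define g where "g t = f (t + length u) - length u" for t
  have g: "f (t + length u) = g t + length u" "g t < length v" if "t < length v" for t
    using first[of "t + length u"] lt[of "t + length u"] that by (auto simp: g_def n_def)
  have "word_iso v v' g"
    unfolding word_iso_def
  proof (intro conjI allI impI)
    have "inj_on g {..<length v}"
    proof (rule inj_onI)
      fix s t assume "s \<in> {..<length v}" "t \<in> {..<length v}" "g s = g t"
      then have "f (s + length u) = f (t + length u)" "s + length u < n" "t + length u < n"
        using g by (auto simp: n_def)
      then show "s = t" using bij by (auto simp: bij_betw_def dest!: inj_onD)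
    qed
    moreover have "g ` {..<length v} = {..<length v}"
      by (rule card_subset_eq) (use g calculation in \<open>auto simp: card_image\<close>)
    ultimately show "bij_betw g {..<length v} {..<length v'}" using len by (simp add: bij_betw_def)
    fix s t assume st: "s < length v" "t < length v"
    then have "s + length u < n" "t + length u < n" by (simp_all add: n_def)
    note xy = x[OF this] y[OF this]
    show "xless v s t \<longleftrightarrow> xless v' (g s) (g t)" "yless v s t \<longleftrightarrow> yless v' (g s) (g t)"
      using xy unfolding g(1)[OF st(1)] g(1)[OF st(2)] word_less_append_right
      unfolding len word_less_append_right by simp_all
  qed
  then show "pattern v = pattern v'" using iso_imp_pattern_eq len by blast
qed

text \<open>One representative word is fixed for each pattern. With the letter counts
  \<open>M\<close> and \<open>N\<close> prescribed, cancellation makes the concatenation of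
  representatives injective on pairs of patterns.\<close>

lemma card_patterns_mult_le:
  "card (pattern ` {w. mset w = M}) * card (pattern ` {w. mset w = N})
    \<le> card (pattern ` {w. mset w = M + N})"
proof -
  let ?D = "\<lambda>M. pattern ` {w. mset w = M}"
  define W where "W M \<pi> = (SOME w. mset w = M \<and> pattern w = \<pi>)" for M \<pi>
  have W: "mset (W M \<pi>) = M \<and> pattern (W M \<pi>) = \<pi>" if "\<pi> \<in> ?D M" for M \<pi>
    unfolding W_def by (rule someI_ex) (use that in auto)
  have "card (?D M \<times> ?D N) \<le> card (?D (M + N))"
  proof (rule card_inj_on_le)
    show "inj_on (\<lambda>(\<pi>, \<rho>). pattern (W M \<pi> @ W N \<rho>)) (?D M \<times> ?D N)"
    proof (rule inj_onI, clarify)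
      fix u v u' v'
      let ?p = "pattern u" and ?q = "pattern v" and ?p' = "pattern u'" and ?q' = "pattern v'"
      assume eq: "pattern (W (mset u) ?p @ W (mset v) ?q) = pattern (W (mset u) ?p' @ W (mset v) ?q')"
        and "mset u' = mset u" "mset v' = mset v"
      then have p: "?p \<in> ?D (mset u)" "?p' \<in> ?D (mset u)" "?q \<in> ?D (mset v)" "?q' \<in> ?D (mset v)" by auto
      show "?p = ?p' \<and> ?q = ?q'"
        using pattern_append_cancel[OF eq] W[OF p(1)] W[OF p(2)] W[OF p(3)] W[OF p(4)] by simp
    qed
    show "(\<lambda>(\<pi>, \<rho>). pattern (W M \<pi> @ W N \<rho>)) ` (?D M \<times> ?D N) \<subseteq> ?D (M + N)"
      using W by fastforce
    show "finite (?D (M + N))"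
      using ex_mset[of "M + N"] mset_eq_finite by (metis finite_imageI)
  qed
  then show ?thesis by (simp add: card_cartesian_product)
qed

text \<open>Exchanging position \<open>t\<close> with \<open>n - 1 - t\<close> applies
  \<open>\<phi>\<close> to the letter. Distinct lines change order because \<open>\<phi>\<close>
  reflects their numbers; within a line the direction is kept while the positions are reversed. So
  both orders are reversed, the same word draws \<open>rev_comp n \<pi>\<close>, and uniqueness
  gives equality.\<close>

lemma rev_comp_pattern_palindrome:
  assumes flip: "\<And>c. c \<in> set w \<Longrightarrow> \<phi> (\<phi> c) = c"
    and x: "\<And>c. c \<in> set w \<Longrightarrow> kx (\<phi> c) = a - kx c \<and> upx (\<phi> c) = upx c"
    and y: "\<And>c. c \<in> set w \<Longrightarrow> ky (\<phi> c) = b - ky c \<and> upy (\<phi> c) = upy c"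
  shows "rev_comp (2 * length w) (pattern (w @ rev (map \<phi> w))) = pattern (w @ rev (map \<phi> w))"
proof -
  define W where "W = w @ rev (map \<phi> w)"
  define n where "n = length W"
  have n: "n = 2 * length w" by (simp add: n_def W_def)
  define m where "m t = n - 1 - t" for t
  have m: "m t < n" "m (m t) = t" if "t < n" for t using that by (auto simp: m_def)
  have W_m: "W ! m t = \<phi> (W ! t)" if "t < n" for t
  proof (cases "t < length w")
    case True
    then obtain q where "m t = length w + q" "q < length w" "length w - Suc q = t"
      using n that[of "length w - 1 - t"] by (auto simp: m_def)
    then show ?thesis using True by (simp add: W_def nth_append rev_nth)
  next
    case False
    then obtain q where q: "t = length w + q" "q < length w"
      using \<open>t < n\<close> n by (metis add_less_cancel_left le_add_diff_inverse linorder_not_less mult_2)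
    then have "m t = length w - 1 - q" using n by (simp add: m_def)
    moreover have "length w - 1 - q < length w" using q by linarith
    ultimately show ?thesis using q flip by (simp add: W_def nth_append rev_nth)
  qed
  have W_set: "kx (\<phi> c) = a - kx c \<and> upx (\<phi> c) = upx c \<and> ky (\<phi> c) = b - ky c \<and> upy (\<phi> c) = upy c"
    if "c \<in> set W" for c
    using that x y flip by (force simp: W_def)
  have rev: "xless W (m s) (m t) \<longleftrightarrow> xless W t s" "yless W (m s) (m t) \<longleftrightarrow> yless W t s"
    if "s < n" "t < n" for s t
  proof -
    have ms: "m s < m t \<longleftrightarrow> t < s" "m t < m s \<longleftrightarrow> s < t" using that by (auto simp: m_def)
    have in_W: "W ! s \<in> set W" "W ! t \<in> set W" using that by (auto simp: n_def)
    show "xless W (m s) (m t) \<longleftrightarrow> xless W t s" "yless W (m s) (m t) \<longleftrightarrow> yless W t s"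
      using W_set[OF in_W(1)] W_set[OF in_W(2)] W_m that ms upx[of "W ! s" "W ! t"] upy[of "W ! s" "W ! t"]
      by (auto simp: word_less_def)
  qed
  define \<pi> where "\<pi> = pattern W"
  obtain e where e: "bij_betw e {..<n} {1..n}" "\<And>s t. s < n \<Longrightarrow> t < n \<Longrightarrow>
      (xless W s t \<longleftrightarrow> e s < e t) \<and> (yless W s t \<longleftrightarrow> \<pi> (e s) < \<pi> (e t))"
    using draws_iff_pattern[of W \<pi>] unfolding draws_def n_def \<pi>_def by blast
  have \<pi>: "\<pi> permutes {1..n}" using pattern_permutes by (simp add: \<pi>_def n_def)
  define r where "r i = n + 1 - i" for i
  have r: "bij_betw r {1..n} {1..n}"
    by (rule bij_betw_byWitness[where f' = r]) (auto simp: r_def)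
  have "bij_betw m {..<n} {..<n}"
    by (rule bij_betw_byWitness[where f' = m]) (use m in auto)
  then have e': "bij_betw (r \<circ> (e \<circ> m)) {..<n} {1..n}"
    using e(1) r by (blast intro: bij_betw_trans)
  have \<pi>_bij: "bij_betw \<pi> {1..n} {1..n}" using \<pi> by (rule permutes_imp_bij)
  have "bij_betw (r \<circ> (\<pi> \<circ> r)) {1..n} {1..n}"
    using r \<pi>_bij by (blast intro: bij_betw_trans)
  then have "bij_betw (rev_comp n \<pi>) {1..n} {1..n}"
    by (rule bij_betw_cong[THEN iffD1, rotated]) (simp add: rev_comp_def r_def)
  then have perm: "rev_comp n \<pi> permutes {1..n}"
    by (rule bij_imp_permutes) (auto simp: rev_comp_def)
  have e_range: "e t \<in> {1..n}" if "t < n" for t using e(1) that by (auto simp: bij_betw_def)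
  have \<pi>_range: "\<pi> i \<in> {1..n}" if "i \<in> {1..n}" for i using \<pi>_bij that by (auto simp: bij_betw_def)
  have rc: "rev_comp n \<pi> (r i) = r (\<pi> i)" if "i \<in> {1..n}" for i
    using that by (auto simp: rev_comp_def r_def)
  have r_less: "r i < r j \<longleftrightarrow> j < i" if "i \<in> {1..n}" "j \<in> {1..n}" for i j
    using that by (auto simp: r_def)
  have "draws W (rev_comp n \<pi>)"
    unfolding draws_def n_def[symmetric]
  proof (intro conjI exI[of _ "r \<circ> (e \<circ> m)"] perm e' allI impI)
    fix s t assume st: "s < n" "t < n"
    show "xless W s t \<longleftrightarrow> (r \<circ> (e \<circ> m)) s < (r \<circ> (e \<circ> m)) t"
      using st rev[of t s] e(2)[of "m t" "m s"] m r_less e_range by simp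
    show "yless W s t \<longleftrightarrow> rev_comp n \<pi> ((r \<circ> (e \<circ> m)) s) < rev_comp n \<pi> ((r \<circ> (e \<circ> m)) t)"
      using st rev[of t s] e(2)[of "m t" "m s"] m r_less e_range \<pi>_range rc by simp
  qed
  then show ?thesis using draws_iff_pattern n unfolding \<pi>_def W_def by simp
qed

end

section \<open>Geometric grid classes as sets of patterns\<close>

lemma word_less_iff_coord_less:
  fixes d :: "nat \<Rightarrow> real" and w :: "'c list"
  assumes "\<And>c c'. k c = k c' \<Longrightarrow> up c = up c'"
    and mono: "\<And>s t. s \<le> t \<Longrightarrow> t < n \<Longrightarrow> d s \<le> d t"
    and unit: "\<And>t. t < n \<Longrightarrow> 0 \<le> d t \<and> d t \<le> 1"
  defines "z \<equiv> \<lambda>t. real_of_int (k (w ! t)) + (if up (w ! t) then d t else 1 - d t)"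
  assumes inj: "inj_on z {..<n}" and st: "s < n" "t < n"
  shows "word_less k up w s t \<longleftrightarrow> z s < z t"
proof -
  have less: "z s < z t" if "word_less k up w s t" "s < n" "t < n" for s t
  proof -
    \<comment> \<open>Neighbouring lines share a boundary and distances may tie, so only the weak
      inequality follows at first; injectivity of \<open>z\<close> makes it strict.\<close>
    have "z s \<le> z t"
    proof (cases "k (w ! s) < k (w ! t)")
      case True
      then have "real_of_int (k (w ! s)) + 1 \<le> real_of_int (k (w ! t))" by linarith
      then show ?thesis using unit[of s] unit[of t] that by (auto simp: z_def)
    next
      case False
      then have "k (w ! s) = k (w ! t)" "up (w ! s) = up (w ! t)" "if up (w ! s) then s < t else t < s"
        using that(1) assms(1)[of "w ! s" "w ! t"] by (auto simp: word_less_def)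
      then show ?thesis using mono[of s t] mono[of t s] that by (auto simp: z_def split: if_splits)
    qed
    moreover have "s \<noteq> t" using that(1) by (auto simp: word_less_def)
    then have "z s \<noteq> z t" using inj that by (auto dest: inj_onD)
    ultimately show ?thesis by linarith
  qed
  show ?thesis
  proof (cases "s = t")
    case True
    then show ?thesis by (simp add: word_less_def)
  next
    case False
    then have "word_less k up w s t \<or> word_less k up w t s"
      by (intro word_less_total[of k up s t w] assms(1))
    then show ?thesis using less[of s t] less[of t s] st by (meson less_asym)
  qed
qed

lemma closed_segment_slope_up:
  "p \<in> closed_segment (x, y) (x + 1, y + 1) \<longleftrightarrow> (\<exists>d. 0 \<le> d \<and> d \<le> 1 \<and> p = (x + d, y + d))"
  for x y :: real
proof -
  have "(1 - d) *\<^sub>R (x, y) + d *\<^sub>R (x + 1, y + 1) = (x + d, y + d)" for d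
    by (simp add: algebra_simps)
  then show ?thesis by (auto simp: closed_segment_def)
qed

lemma closed_segment_slope_down:
  "p \<in> closed_segment (x, y + 1) (x + 1, y) \<longleftrightarrow> (\<exists>d. 0 \<le> d \<and> d \<le> 1 \<and> p = (x + d, y + (1 - d)))"
  for x y :: real
proof -
  have "(1 - d) *\<^sub>R (x, y + 1) + d *\<^sub>R (x + 1, y) = (x + d, y + (1 - d))" for d
    by (simp add: algebra_simps)
  then show ?thesis by (auto simp: closed_segment_def)
qed

section \<open>Points on the figure of an oriented matrix\<close>

locale oriented_matrix =
  fixes A :: "int mat" and colup rowup :: "nat \<Rightarrow> bool"
  assumes orientation: "(i, j) \<in> nonzero_cells A \<Longrightarrow> A $$ (i, j) = (if colup j = rowup i then 1 else -1)"

text \<open>Rows are numbered from the top, so the vertical position of a cell is the negated row index.\<close>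

sublocale oriented_matrix \<subseteq>
  word_diagram "\<lambda>c. int (snd c)" "\<lambda>c. - int (fst c)" "\<lambda>c. colup (snd c)" "\<lambda>c. rowup (fst c)"
  by unfold_locales (auto simp: prod_eq_iff)

context oriented_matrix
begin

text \<open>The point of the diagonal of \<open>c\<close> whose horizontal and vertical distances
  from the base point are \<open>d\<close>; the base point is the corner where the directions of
  column and row start. The vertical shift is kept outside so that the inner term has the form used
  in \<open>word_less_iff_coord_less\<close>.\<close>

definition cell_point :: "nat \<times> nat \<Rightarrow> real \<Rightarrow> real \<times> real" where
  "cell_point c d =
    (real_of_int (int (snd c)) + (if colup (snd c) then d else 1 - d),
     real (dim_row A) - 1 + (real_of_int (- int (fst c)) + (if rowup (fst c) then d else 1 - d)))"

lemma standard_figure_eq: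
  "p \<in> standard_figure A \<longleftrightarrow> (\<exists>c\<in>nonzero_cells A. \<exists>d. 0 \<le> d \<and> d \<le> 1 \<and> p = cell_point c d)"
proof -
  have seg: "p \<in> cell_segment A i j \<longleftrightarrow>
      (i, j) \<in> nonzero_cells A \<and> (\<exists>d. 0 \<le> d \<and> d \<le> 1 \<and> p = cell_point (i, j) d)"
    if ij: "i < dim_row A" "j < dim_col A" for i j
  proof (cases "A $$ (i, j) = 0")
    case True
    then show ?thesis by (simp add: cell_segment_def nonzero_cells_def)
  next
    case False
    then have nz: "(i, j) \<in> nonzero_cells A" using ij by (simp add: nonzero_cells_def)
    \<comment> \<open>The segment is parametrized from its left end, \<open>cell_point\<close> from
      the base point; the parameter has to be reflected when \<open>colup j\<close> fails.\<close>
    have flip: "(\<exists>d. 0 \<le> d \<and> d \<le> 1 \<and> Q d) \<longleftrightarrow> (\<exists>d. 0 \<le> d \<and> d \<le> 1 \<and> Q (1 - d))" for Q :: "real \<Rightarrow> bool"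
    proof
      assume "\<exists>d. 0 \<le> d \<and> d \<le> 1 \<and> Q d"
      then obtain d where "0 \<le> d" "d \<le> 1" "Q d" by blast
      then show "\<exists>d. 0 \<le> d \<and> d \<le> 1 \<and> Q (1 - d)" by (intro exI[of _ "1 - d"]) simp
    next
      assume "\<exists>d. 0 \<le> d \<and> d \<le> 1 \<and> Q (1 - d)"
      then obtain d where "0 \<le> d" "d \<le> 1" "Q (1 - d)" by blast
      then show "\<exists>d. 0 \<le> d \<and> d \<le> 1 \<and> Q d" by (intro exI[of _ "1 - d"]) simp
    qed
    let ?x = "real j" and ?y = "real (dim_row A) - 1 - real i"
    have "cell_segment A i j = (if colup j = rowup i then closed_segment (?x, ?y) (?x + 1, ?y + 1)
        else closed_segment (?x, ?y + 1) (?x + 1, ?y))"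
      using orientation[OF nz] by (simp add: cell_segment_def Let_def)
    then have "p \<in> cell_segment A i j \<longleftrightarrow>
      (\<exists>d. 0 \<le> d \<and> d \<le> 1 \<and> p = (?x + d, ?y + (if colup j = rowup i then d else 1 - d)))"
      by (cases "colup j = rowup i")
        (simp_all only: simp_thms if_True if_False closed_segment_slope_up closed_segment_slope_down)
    also have "\<dots> \<longleftrightarrow> (\<exists>d. 0 \<le> d \<and> d \<le> 1 \<and> p = cell_point (i, j) d)"
    proof (cases "colup j")
      case True
      then show ?thesis by (simp add: cell_point_def algebra_simps)
    next
      case False
      then show ?thesis
        by (subst flip, cases "rowup i") (simp_all add: cell_point_def algebra_simps)
    qed
    finally show ?thesis using nz by simp
  qed
  show ?thesis
  proof
    assume "p \<in> standard_figure A"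
    then show "\<exists>c\<in>nonzero_cells A. \<exists>d. 0 \<le> d \<and> d \<le> 1 \<and> p = cell_point c d"
      unfolding standard_figure_def using seg by blast
  next
    assume "\<exists>c\<in>nonzero_cells A. \<exists>d. 0 \<le> d \<and> d \<le> 1 \<and> p = cell_point c d"
    then obtain i j d where "(i, j) \<in> nonzero_cells A" "0 \<le> d" "d \<le> 1" "p = cell_point (i, j) d"
      by auto
    moreover then have "i < dim_row A" "j < dim_col A" by (auto simp: nonzero_cells_def)
    ultimately show "p \<in> standard_figure A" unfolding standard_figure_def using seg by blast
  qed
qed

lemma cell_point_word_less:
  assumes mono: "\<And>s t. s \<le> t \<Longrightarrow> t < n \<Longrightarrow> d s \<le> d t"
    and unit: "\<And>t. t < n \<Longrightarrow> 0 \<le> d t \<and> d t \<le> 1"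
    and inj: "inj_on (\<lambda>t. fst (cell_point (w ! t) (d t))) {..<n}"
      "inj_on (\<lambda>t. snd (cell_point (w ! t) (d t))) {..<n}"
    and st: "s < n" "t < n"
  shows "xless w s t \<longleftrightarrow> fst (cell_point (w ! s) (d s)) < fst (cell_point (w ! t) (d t))"
    and "yless w s t \<longleftrightarrow> snd (cell_point (w ! s) (d s)) < snd (cell_point (w ! t) (d t))"
proof -
  show "xless w s t \<longleftrightarrow> fst (cell_point (w ! s) (d s)) < fst (cell_point (w ! t) (d t))"
    using word_less_iff_coord_less[of "\<lambda>c. int (snd c)" "\<lambda>c. colup (snd c)" n d w s t, OF upx mono unit]
      inj(1) st by (simp add: cell_point_def)
  have "inj_on (\<lambda>t. real_of_int (- int (fst (w ! t))) + (if rowup (fst (w ! t)) then d t else 1 - d t)) {..<n}"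
    using inj(2) unfolding cell_point_def snd_conv inj_on_def by (metis (no_types, lifting))
  from word_less_iff_coord_less[of "\<lambda>c. - int (fst c)" "\<lambda>c. rowup (fst c)" n d w, OF upy mono unit this st]
  show "yless w s t \<longleftrightarrow> snd (cell_point (w ! s) (d s)) < snd (cell_point (w ! t) (d t))"
    by (simp add: cell_point_def)
qed

lemma pattern_in_Geom:
  assumes w: "set w \<subseteq> nonzero_cells A"
  shows "pattern w \<in> Geom A (length w)"
proof -
  define n where "n = length w"
  \<comment> \<open>Strictly increasing distances inside the open unit interval: points avoid the
    cell borders, so coordinates in different lines never coincide, and within a line the distances
    tell them apart.\<close>
  define d :: "nat \<Rightarrow> real" where "d t = (real t + 1) / (real n + 1)" for t
  define p where "p t = cell_point (w ! t) (d t)" for t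
  have unit: "0 < d t" "d t < 1" if "t < n" for t using that by (auto simp: d_def field_simps)
  have unit': "0 \<le> d t \<and> d t \<le> 1" if "t < n" for t using unit[OF that] by simp
  have mono: "d s \<le> d t" if "s \<le> t" "t < n" for s t using that by (simp add: d_def divide_right_mono)
  have d_inj: "s = t" if "d s = d t" for s t using that by (simp add: d_def)
  have coord: "s = t" if "k s = k t \<Longrightarrow> u s = u t" "s < n" "t < n" and
      "real_of_int (k s) + (if u s then d s else 1 - d s) = real_of_int (k t) + (if u t then d t else 1 - d t)"
    for k :: "nat \<Rightarrow> int" and u s t
  proof -
    have "\<bar>real_of_int (k s) - real_of_int (k t)\<bar> < 1"
      using that(4) unit[OF that(2)] unit[OF that(3)] by (auto split: if_splits)
    then have "k s = k t" by linarith
    then have "d s = d t" using that(1,4) by (auto split: if_splits)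
    then show ?thesis by (rule d_inj)
  qed
  have inj: "inj_on (\<lambda>t. fst (p t)) {..<n}" "inj_on (\<lambda>t. snd (p t)) {..<n}"
  proof -
    show "inj_on (\<lambda>t. fst (p t)) {..<n}"
      using coord[of "\<lambda>t. int (snd (w ! t))" _ _ "\<lambda>t. colup (snd (w ! t))"]
      by (intro inj_onI) (simp add: p_def cell_point_def)
    show "inj_on (\<lambda>t. snd (p t)) {..<n}"
      using coord[of "\<lambda>t. - int (fst (w ! t))" _ _ "\<lambda>t. rowup (fst (w ! t))"]
      by (intro inj_onI) (simp add: p_def cell_point_def)
  qed
  have less: "xless w s t \<longleftrightarrow> fst (p s) < fst (p t)" "yless w s t \<longleftrightarrow> snd (p s) < snd (p t)"
    if "s < n" "t < n" for s t
    using cell_point_word_less[of n d w s t, OF mono unit' inj[unfolded p_def] that] by (simp_all add: p_def)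
  obtain e where e: "bij_betw e {..<n} {1..n}" "\<And>s t. s < n \<Longrightarrow> t < n \<Longrightarrow>
      (xless w s t \<longleftrightarrow> e s < e t) \<and> (yless w s t \<longleftrightarrow> pattern w (e s) < pattern w (e t))"
    using draws_iff_pattern[of w "pattern w"] unfolding draws_def n_def by blast
  define P where "P = p ` {..<n}"
  define g where "g = inv_into {..<n} e"
  have g: "bij_betw g {1..n} {..<n}" unfolding g_def using e(1) by (rule bij_betw_inv_into)
  have eg: "e (g i) = i" "g i < n" if "i \<in> {1..n}" for i
    using bij_betw_inv_into_right[OF e(1) that] bij_betwE[OF g] that by (simp_all add: g_def)
  have p_inj: "inj_on p {..<n}" using inj(1) by (auto simp: inj_on_def)
  show ?thesis
    unfolding Geom_def n_def[symmetric]
  proof (intro CollectI conjI exI[of _ P])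
    show "pattern w permutes {1..n}" using pattern_permutes by (simp add: n_def)
    show "P \<subseteq> standard_figure A"
    proof
      fix a assume "a \<in> P"
      then obtain t where "t < n" "a = cell_point (w ! t) (d t)" by (auto simp: P_def p_def)
      moreover have "w ! t \<in> nonzero_cells A" using w calculation by (auto simp: n_def)
      ultimately show "a \<in> standard_figure A"
        using unit[of t] by (auto simp: standard_figure_eq intro!: bexI[of _ "w ! t"] exI[of _ "d t"])
    qed
    show "finite P" by (simp add: P_def)
    show "card P = n" using p_inj by (simp add: P_def card_image)
    show "inj_on fst P" "inj_on snd P" using inj by (auto simp: P_def inj_on_def)
    show "same_relative_order n (pattern w) P"
      unfolding same_relative_order_def
    proof (intro exI[of _ "p \<circ> g"] conjI ballI)
      have "bij_betw p {..<n} P" using p_inj by (simp add: P_def bij_betw_def)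
      then show "bij_betw (p \<circ> g) {1..n} P" using g by (rule bij_betw_trans[rotated])
      fix i j assume ij: "i \<in> {1..n}" "j \<in> {1..n}"
      show "fst ((p \<circ> g) i) < fst ((p \<circ> g) j) \<longleftrightarrow> i < j"
        "snd ((p \<circ> g) i) < snd ((p \<circ> g) j) \<longleftrightarrow> pattern w i < pattern w j"
        using less[of "g i" "g j"] e(2)[of "g i" "g j"] eg[OF ij(1)] eg[OF ij(2)] by auto
    qed
  qed
qed

text \<open>
  Points of different cells may be equally far from their base points, but then the cells share
  neither a row nor a column, so that their order in the word does not matter.
\<close>

lemma Geom_imp_pattern:
  assumes "\<pi> \<in> Geom A n"
  shows "\<exists>w. set w \<subseteq> nonzero_cells A \<and> length w = n \<and> \<pi> = pattern w"
proof -
  obtain P where \<pi>: "\<pi> permutes {1..n}" and P: "P \<subseteq> standard_figure A" "inj_on fst P" "inj_on snd P"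
      and "same_relative_order n \<pi> P"
    using assms by (auto simp: Geom_def)
  then obtain q where q: "bij_betw q {1..n} P" "\<And>i j. i \<in> {1..n} \<Longrightarrow> j \<in> {1..n} \<Longrightarrow>
      (fst (q i) < fst (q j) \<longleftrightarrow> i < j) \<and> (snd (q i) < snd (q j) \<longleftrightarrow> \<pi> i < \<pi> j)"
    unfolding same_relative_order_def by blast
  have "\<forall>i\<in>{1..n}. \<exists>c d. c \<in> nonzero_cells A \<and> 0 \<le> d \<and> d \<le> 1 \<and> q i = cell_point c d"
    using bij_betwE[OF q(1)] P(1) standard_figure_eq by blast
  then obtain c d where cd: "\<And>i. i \<in> {1..n} \<Longrightarrow>
      c i \<in> nonzero_cells A \<and> 0 \<le> d i \<and> d i \<le> 1 \<and> q i = cell_point (c i) (d i)"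
    by metis
  \<comment> \<open>The points, given by their horizontal ranks, are read in order of distance from
    the base points; thus \<open>(!) xs\<close> is the rank function required by
    \<open>draws\<close>.\<close>
  define xs where "xs = sort_key d [1..<n + 1]"
  define w where "w = map c xs"
  have xs: "set xs = {1..n}" "distinct xs" "length xs = n" "sorted (map d xs)"
    by (auto simp: xs_def)
  have w: "length w = n" by (simp add: w_def xs)
  have e: "bij_betw ((!) xs) {..<n} {1..n}" using bij_betw_nth[OF xs(2)] xs by simp
  have in_xs: "xs ! t \<in> {1..n}" if "t < n" for t using bij_betwE[OF e] that by simp
  have mono: "d (xs ! s) \<le> d (xs ! t)" if "s \<le> t" "t < n" for s t
    using sorted_nth_mono[OF xs(4), of s t] that xs(3) by simp
  have unit: "0 \<le> d (xs ! t) \<and> d (xs ! t) \<le> 1" if "t < n" for t using cd in_xs that by blast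
  have pt: "cell_point (w ! t) (d (xs ! t)) = q (xs ! t)" if "t < n" for t
    using cd[OF in_xs[OF that]] that xs(3) by (simp add: w_def)
  have bij: "bij_betw (q \<circ> (!) xs) {..<n} P" using e q(1) by (rule bij_betw_trans)
  have "inj_on (fst \<circ> (q \<circ> (!) xs)) {..<n}" "inj_on (snd \<circ> (q \<circ> (!) xs)) {..<n}"
    using bij P by (auto simp: bij_betw_def intro!: comp_inj_on)
  then have inj: "inj_on (\<lambda>t. fst (cell_point (w ! t) (d (xs ! t)))) {..<n}"
      "inj_on (\<lambda>t. snd (cell_point (w ! t) (d (xs ! t)))) {..<n}"
    by (auto simp: inj_on_def pt)
  have "draws w \<pi>"
    unfolding draws_def w
  proof (intro conjI \<pi> exI[of _ "(!) xs"] e allI impI)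
    fix s t assume st: "s < n" "t < n"
    show "xless w s t \<longleftrightarrow> xs ! s < xs ! t" "yless w s t \<longleftrightarrow> \<pi> (xs ! s) < \<pi> (xs ! t)"
      using cell_point_word_less[of n "\<lambda>t. d (xs ! t)" w s t, OF mono unit inj st]
        q(2)[OF in_xs[OF st(1)] in_xs[OF st(2)]] pt[OF st(1)] pt[OF st(2)] by auto
  qed
  moreover have "set w \<subseteq> nonzero_cells A" using cd xs(1) by (auto simp: w_def)
  ultimately show ?thesis using w draws_iff_pattern by blast
qed

lemma Geom_eq_patterns: "Geom A n = pattern ` {w. set w \<subseteq> nonzero_cells A \<and> length w = n}"
  using Geom_imp_pattern pattern_in_Geom by blast

end

section \<open>Centrosymmetric patterns and comparison of growth rates\<close>

locale symmetric_oriented_matrix = oriented_matrix +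
  assumes centro: "centrosymmetric_mat A"
    and colup_flip: "j < dim_col A \<Longrightarrow> colup (dim_col A - 1 - j) = colup j"
    and rowup_flip: "i < dim_row A \<Longrightarrow> rowup (dim_row A - 1 - i) = rowup i"
begin

lemma palindrome_pattern_centrosymmetric:
  assumes w: "set w \<subseteq> nonzero_cells A"
  shows "pattern (w @ rev (map (cell_flip A) w)) \<in> centrosymmetric_part (Geom A) (2 * length w)"
proof -
  have "set (w @ rev (map (cell_flip A) w)) \<subseteq> nonzero_cells A"
    using w cell_flip_nonzero(1)[OF centro] by auto
  from pattern_in_Geom[OF this]
  have "pattern (w @ rev (map (cell_flip A) w)) \<in> Geom A (2 * length w)"
    by (simp add: mult_2)
  moreover have "rev_comp (2 * length w) (pattern (w @ rev (map (cell_flip A) w)))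
      = pattern (w @ rev (map (cell_flip A) w))"
  \<comment> \<open>Rows are numbered by negated indices from \<open>1 - dim_row A\<close> to 0, so
    reflecting them means subtracting from \<open>1 - dim_row A\<close>.\<close>
  proof (rule rev_comp_pattern_palindrome[where a = "int (dim_col A) - 1" and b = "1 - int (dim_row A)"])
    fix c assume "c \<in> set w"
    then have c: "c \<in> nonzero_cells A" "fst c < dim_row A" "snd c < dim_col A"
      using w by (auto simp: nonzero_cells_def)
    then show "cell_flip A (cell_flip A c) = c" using cell_flip_nonzero[OF centro] by blast
    show "int (snd (cell_flip A c)) = int (dim_col A) - 1 - int (snd c) \<and>
        colup (snd (cell_flip A c)) = colup (snd c)"
      using c colup_flip by (auto simp: cell_flip_def)
    show "- int (fst (cell_flip A c)) = 1 - int (dim_row A) - - int (fst c) \<and>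
        rowup (fst (cell_flip A c)) = rowup (fst c)"
      using c rowup_flip by (auto simp: cell_flip_def)
  qed
  ultimately show ?thesis by (simp add: centrosymmetric_part_def)
qed

text \<open>In the palindromic words the second halves also share their letter counts, namely the
  image of \<open>M\<close> under the half turn, so cancellation recovers the pattern of the first
  half.\<close>

lemma card_patterns_le_centrosymmetric:
  assumes M: "set_mset M \<subseteq> nonzero_cells A" "size M = n"
  shows "card (pattern ` {w. mset w = M}) \<le> card (centrosymmetric_part (Geom A) (2 * n))"
proof -
  let ?D = "pattern ` {w. mset w = M}"
  define W where "W \<pi> = (SOME w. mset w = M \<and> pattern w = \<pi>)" for \<pi>
  have W: "mset (W \<pi>) = M \<and> pattern (W \<pi>) = \<pi>" if "\<pi> \<in> ?D" for \<pi>
    unfolding W_def by (rule someI_ex) (use that in auto)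
  show ?thesis
  proof (rule card_inj_on_le)
    show "inj_on (\<lambda>\<pi>. pattern (W \<pi> @ rev (map (cell_flip A) (W \<pi>)))) ?D"
    proof (rule inj_onI)
      fix \<pi> \<rho> assume p: "\<pi> \<in> ?D" "\<rho> \<in> ?D" and
        eq: "pattern (W \<pi> @ rev (map (cell_flip A) (W \<pi>))) = pattern (W \<rho> @ rev (map (cell_flip A) (W \<rho>)))"
      show "\<pi> = \<rho>" using pattern_append_cancel(1)[OF eq] W[OF p(1)] W[OF p(2)] by simp
    qed
    show "(\<lambda>\<pi>. pattern (W \<pi> @ rev (map (cell_flip A) (W \<pi>)))) ` ?D \<subseteq> centrosymmetric_part (Geom A) (2 * n)"
    proof (rule image_subsetI)
      fix \<pi> assume "\<pi> \<in> ?D"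
      then have "set (W \<pi>) \<subseteq> nonzero_cells A" "length (W \<pi>) = n"
        using W M by (metis set_mset_mset, metis size_mset)
      then show "pattern (W \<pi> @ rev (map (cell_flip A) (W \<pi>))) \<in> centrosymmetric_part (Geom A) (2 * n)"
        using palindrome_pattern_centrosymmetric by blast
    qed
    show "finite (centrosymmetric_part (Geom A) (2 * n))"
      by (rule finite_subset[OF _ finite_permutations[of "{1..2 * n}"]])
        (auto simp: centrosymmetric_part_def Geom_def)
  qed
qed

theorem growth_rate_centrosymmetric:
  "ereal (lim (\<lambda>n. root n (real (card (Geom A n)))))
    \<le> liminf (\<lambda>n. ereal (root n (real (card (centrosymmetric_part (Geom A) (2 * n))))))"
proof (cases "nonzero_cells A = {}")
  \<comment> \<open>Without non-zero cells there are no words of positive length, hence no multisets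
    to maximize over. The roots are then all 0, at \<open>n = 0\<close> because
    \<open>root 0\<close> is 0 by convention.\<close>
  case True
  have "root n (real (card (Geom A n))) = 0" for n
    using True by (cases n) (auto simp: Geom_eq_patterns)
  then have "lim (\<lambda>n. root n (real (card (Geom A n)))) = 0" by (simp add: limI)
  moreover have "0 \<le> liminf (\<lambda>n. ereal (root n (real (card (centrosymmetric_part (Geom A) (2 * n))))))"
    by (intro Liminf_bounded always_eventually) (simp add: real_root_ge_zero)
  ultimately show ?thesis by (simp add: zero_ereal_def)
next
  case False
  define Z where "Z = nonzero_cells A"
  have fin: "finite Z" by (simp add: Z_def finite_nonzero_cells)
  define V where "V n = {M. set_mset M \<subseteq> Z \<and> size M = n}" for n
  define D where "D M = pattern ` {w. mset w = M}" for M
  define y where "y n = Max ((\<lambda>M. card (D M)) ` V n)" for n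
  have V_fin: "finite (V n)" and V_card: "card (V n) \<le> (n + 1) ^ card Z" for n
    using card_multisets_le[OF fin, of n] by (auto simp: V_def)
  obtain z where z: "z \<in> Z" using False by (auto simp: Z_def)
  have "replicate_mset n z \<in> V n" for n using z by (auto simp: V_def)
  then have V_ne: "V n \<noteq> {}" for n by blast
  have D_Geom: "D M \<subseteq> Geom A n" if "M \<in> V n" for M n
    using that unfolding D_def V_def Z_def Geom_eq_patterns by auto
  have Geom_fin: "finite (Geom A n)" for n
    by (rule finite_subset[OF _ finite_permutations[of "{1..n}"]]) (auto simp: Geom_def)
  have y_ge: "card (D M) \<le> y n" if "M \<in> V n" for M n
    using that V_fin by (auto simp: y_def)
  have y_ex: "\<exists>M\<in>V n. y n = card (D M)" for n
  proof -
    have "y n \<in> (\<lambda>M. card (D M)) ` V n" unfolding y_def using V_fin V_ne by (intro Max_in) auto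
    then show ?thesis by auto
  qed
  have y_le: "y n \<le> card (Geom A n)" for n
    using y_ex[of n] D_Geom card_mono[OF Geom_fin] by metis
  have super: "y m * y n \<le> y (m + n)" for m n
  proof -
    obtain M N where MN: "M \<in> V m" "y m = card (D M)" "N \<in> V n" "y n = card (D N)"
      using y_ex by metis
    then have "M + N \<in> V (m + n)" by (auto simp: V_def)
    from y_ge[OF this] card_patterns_mult_le[of M N]
    show ?thesis unfolding MN(2,4) D_def by linarith
  qed
  have lower: "1 \<le> y n" for n
  proof -
    have "pattern (replicate n z) \<in> D (replicate_mset n z)" by (auto simp: D_def)
    moreover have mem: "replicate_mset n z \<in> V n" using z by (auto simp: V_def)
    ultimately have "0 < card (D (replicate_mset n z))"
      using finite_subset[OF D_Geom[OF mem] Geom_fin] by (auto simp: card_gt_0_iff)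
    then show ?thesis using y_ge[OF mem] by linarith
  qed
  have upper: "y n \<le> card Z ^ n" for n
  proof -
    have "card (Geom A n) \<le> card {w. set w \<subseteq> Z \<and> length w = n}"
      unfolding Geom_eq_patterns Z_def
      using finite_lists_length_eq[OF finite_nonzero_cells] by (intro card_image_le) auto
    then show ?thesis using y_le[of n] card_lists_length_eq[OF fin, of n] by simp
  qed
  \<comment> \<open>Sorting words by their letter multisets covers the class by
    \<open>card (V n)\<close> sets of patterns, each of size at most \<open>y n\<close>.\<close>
  have poly: "card (Geom A n) \<le> (n + 1) ^ card Z * y n" for n
  proof -
    have "Geom A n \<subseteq> (\<Union>M\<in>V n. D M)"
    proof
      fix \<pi> assume "\<pi> \<in> Geom A n"
      then obtain w where w: "set w \<subseteq> Z" "length w = n" "\<pi> = pattern w"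
        using Geom_imp_pattern unfolding Z_def by blast
      show "\<pi> \<in> (\<Union>M\<in>V n. D M)"
        by (rule UN_I[of "mset w"]) (use w in \<open>simp_all add: V_def D_def\<close>)
    qed
    moreover have "finite (\<Union>M\<in>V n. D M)"
      by (rule finite_UN_I[OF V_fin finite_subset[OF D_Geom Geom_fin]])
    ultimately have "card (Geom A n) \<le> card (\<Union>M\<in>V n. D M)" by (rule card_mono[rotated])
    also have "\<dots> \<le> (\<Sum>M\<in>V n. card (D M))" by (rule card_UN_le[OF V_fin])
    also have "\<dots> \<le> card (V n) * y n" using sum_bounded_above[of "V n" "\<lambda>M. card (D M)" "y n"] y_ge by simp
    also have "\<dots> \<le> (n + 1) ^ card Z * y n" using V_card by simp
    finally show ?thesis .
  qed
  have rc: "y n \<le> card (centrosymmetric_part (Geom A) (2 * n))" for n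
    using y_ex[of n] card_patterns_le_centrosymmetric unfolding D_def V_def Z_def by auto
  show ?thesis
  proof (rule liminf_root_ge_lim_root[where y = "\<lambda>n. real (y n)" and B = "real (card Z)" and K = "card Z"])
    show "real (y m) * real (y n) \<le> real (y (m + n))" for m n using super by (simp flip: of_nat_mult)
    show "1 \<le> real (y n)" for n using lower[of n] by simp
    show "real (y n) \<le> real (card Z) ^ n" for n using upper[of n] by (simp flip: of_nat_power)
    show "real (card (Geom A n)) \<le> real (n + 1) ^ card Z * real (y n)" for n
      using of_nat_mono[OF poly[of n], where ?'a = real] by (simp only: of_nat_mult of_nat_power)
    show "real (y n) \<le> real (card (Geom A n))" for n using y_le[of n] by simp
    show "real (y n) \<le> real (card (centrosymmetric_part (Geom A) (2 * n)))" for n using rc[of n] by simp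
  qed
qed

end

theorem theorem1p2:
  fixes A :: "int mat"
  assumes "elements_mat A \<subseteq> {0, 1, -1}"
    and "centrosymmetric_mat A"
    and "cell_graph_forest A"
  shows "liminf (\<lambda>n. ereal (root n (real (card (centrosymmetric_part (Geom A) (2 * n))))))
    \<ge> ereal (lim (\<lambda>n. root n (real (card (Geom A n)))))"
proof -
  obtain colup rowup :: "nat \<Rightarrow> bool" where orientation:
    "\<And>i j. (i, j) \<in> nonzero_cells A \<Longrightarrow> A $$ (i, j) = (if colup j = rowup i then 1 else -1)"
    "\<And>j. j < dim_col A \<Longrightarrow> colup (dim_col A - 1 - j) = colup j"
    "\<And>i. i < dim_row A \<Longrightarrow> rowup (dim_row A - 1 - i) = rowup i"
    by (rule centrosymmetric_forest_orientation[OF assms]) (rule that)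
  interpret symmetric_oriented_matrix A colup rowup
    by unfold_locales (fact orientation assms(2))+
  show ?thesis by (rule growth_rate_centrosymmetric)
qed

end
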